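(* Let $\chi>0$ and $c>e^{\chi}$ be constants and set $\varepsilon:=\sqrt[3]{c/e^{\chi}}-1$. For each $n$, let $f(x)=\sum_{i=1}^n a_ix_i$ with integer weights $a_1\ge\dots\ge a_n>0$. Consider Algorithm 1 where selection is fitness-proportionate with respect to the scaled fitness $g(x):=c^{f(x)}$ (i.e. index $i$ is selected with probability $g(P(i))/\sum_{j}g(P(j))$), mutation is bitwise with rate $\chi/n$, and the population size satisfies $$\lambda\ge\frac{4c}{\varepsilon^3}\ln\!\left(\frac{128(n+1)^2ce}{\varepsilon^3\chi}\right).$$ Then, for all sufficiently large $n$, the expected runtime to find the optimum of $f$ satisfies $$E[T]\le\frac{8}{\varepsilon^2}\left(\lambda n\ln(3\varepsilon\lambda/2)+\frac{n^2ec}{\varepsilon\chi}\right)=O(n\lambda\ln\lambda+n^2).$$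
   Context: Algorithm 1 (non-elitist EA): the search space is $\mathcal X=\{0,1\}^n$; the initial population $P_0\in\mathcal X^\lambda$ is sampled uniformly at random. In each generation $t$, the new population $P_{t+1}$ is formed by $\lambda$ independent repetitions of: sample an index $I=\mathrm{sel}(P_t)\in[\lambda]$ by the selection mechanism and set the offspring to $\mathrm{mutate}(P_t(I))$. Bitwise mutation with rate $\chi/n$ flips each bit independently with probability $\chi/n$. The runtime is $T:=\min\{t\lambda : P_t \text{ contains an optimum of } f\}$, i.e. the number of fitness evaluations until an optimum first appears. *)

theory Defs
  imports "HOL-Probability.Probability"
begin

type_synonym bits = "bool list"
type_synonym population = "bits list"

fun iid_list :: "nat \<Rightarrow> 'a pmf \<Rightarrow> 'a list pmf" where
  "iid_list 0 p = return_pmf []"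
| "iid_list (Suc k) p = do { x \<leftarrow> p; xs \<leftarrow> iid_list k p; return_pmf (x # xs) }"

definition linf :: "(nat \<Rightarrow> nat) \<Rightarrow> bits \<Rightarrow> nat" where
  "linf a x = (\<Sum>i<length x. a i * (if x ! i then 1 else 0))"

definition mutate :: "real \<Rightarrow> nat \<Rightarrow> bits \<Rightarrow> bits pmf" where
  "mutate chi n x = map_pmf (\<lambda>fl. map2 (\<lambda>b f. b \<noteq> f) x fl)
                     (iid_list (length x) (bernoulli_pmf (chi / real n)))"

definition fp_select :: "(bits \<Rightarrow> real) \<Rightarrow> population \<Rightarrow> nat pmf" where
  "fp_select g P = pmf_of_list
     (map (\<lambda>i. (i, g (P ! i) / (\<Sum>j<length P. g (P ! j)))) [0..<length P])"

definition ea_step :: "(population \<Rightarrow> nat pmf) \<Rightarrow> (bits \<Rightarrow> bits pmf) \<Rightarrow> population \<Rightarrow> population pmf" where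
  "ea_step sel mut P = iid_list (length P) (do { I \<leftarrow> sel P; mut (P ! I) })"

definition init_pop :: "nat \<Rightarrow> nat \<Rightarrow> population pmf" where
  "init_pop n lam = iid_list lam (pmf_of_set {x :: bits. length x = n})"

fun trajectory :: "population pmf \<Rightarrow> (population \<Rightarrow> population pmf) \<Rightarrow> nat \<Rightarrow> population list pmf" where
  "trajectory P0 step 0 = map_pmf (\<lambda>P. [P]) P0"
| "trajectory P0 step (Suc t) =
     do { xs \<leftarrow> trajectory P0 step t; P \<leftarrow> step (last xs); return_pmf (xs @ [P]) }"

definition is_optimum :: "nat \<Rightarrow> (bits \<Rightarrow> nat) \<Rightarrow> bits \<Rightarrow> bool" where
  "is_optimum n f x \<longleftrightarrow> length x = n \<and> (\<forall>y. length y = n \<longrightarrow> f y \<le> f x)"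

text \<open>Pr[no optimum in P_0,...,P_t] = Pr[tau > t], where T = tau * lambda.\<close>
definition not_found_prob :: "nat \<Rightarrow> (bits \<Rightarrow> nat) \<Rightarrow> population pmf \<Rightarrow>
     (population \<Rightarrow> population pmf) \<Rightarrow> nat \<Rightarrow> real" where
  "not_found_prob n f P0 step t =
     measure_pmf.prob (trajectory P0 step t)
       {xs. \<forall>P\<in>set xs. \<forall>x\<in>set P. \<not> is_optimum n f x}"

text \<open>E[T] via the tail-sum formula E[T] = sum_{k>=0} Pr[T > k]; since T = lambda * tau,
  Pr[T > k] = Pr[tau > k div lambda]. Value in ennreal (may be infinity).\<close>
definition expected_runtime :: "nat \<Rightarrow> nat \<Rightarrow> (bits \<Rightarrow> nat) \<Rightarrow>
     (population \<Rightarrow> population pmf) \<Rightarrow> ennreal" where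
  "expected_runtime n lam f step =
     (\<Sum>k. ennreal (not_found_prob n f (init_pop n lam) step (k div lam)))"

end

theory Submission
  imports Defs "HOL-Real_Asymp.Real_Asymp"
begin

text \<open>
  For a fitness value \<open>F\<close> let \<open>X F\<close> be the number of individuals of fitness at least \<open>F\<close>, and call \<open>F\<close>
  reached if \<open>X F\<close> is at least a fraction \<open>\<epsilon> / c\<close> of the population; reached values are lost only with
  probability exponentially small in \<open>\<lambda>\<close>. A level consists of a value \<open>M\<close> and a gap \<open>h\<close>. Exponential
  scaling gives a dichotomy: either enough selection mass lies above \<open>M\<close> to reach \<open>M\<close> in the next
  generation, or the mass below \<open>M\<close> dominates and then every individual above \<open>M + h\<close> has more than
  \<open>c ^ h\<close> offspring above \<open>M + h\<close> in expectation. Hence, once an individual of fitness \<open>M + h\<close>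
  has been found, \<open>M\<close> is reached after about \<open>ln \<lambda> / (h ln c)\<close> generations.

  For large \<open>\<epsilon>\<close> the levels given by the prefix sums \<open>a\<^sub>1 + \<dots> + a\<^sub>i\<close> with gap \<open>0\<close> would only give
  \<open>n ln \<lambda> / (3 ln (1 + \<epsilon>))\<close> generations, which exceeds \<open>(8 / \<epsilon>\<^sup>2) n ln \<lambda>\<close>. A large constant gap is
  available because an improvement by a constant amount has probability \<open>\<Omega>(1 / n)\<close>: a heavy zero bit can
  be flipped, or else, far from the optimum, there are linearly many zero bits. Only the last \<open>n / A\<close>
  levels, for a large constant \<open>A\<close>, need gap \<open>0\<close>. The sum over all levels of a logarithmic
  potential plus the waiting time for the first improvement has constant negative drift.
\<close>

section \<open>Independent samples and binomial counts\<close>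

lemma set_pmf_iid_list_subset: "set_pmf (iid_list k p) \<subseteq> {xs. length xs = k \<and> set xs \<subseteq> set_pmf p}"
  by (induction k) fastforce+

lemma finite_set_pmf_iid_list:
  assumes "finite (set_pmf p)"
  shows "finite (set_pmf (iid_list k p))"
  by (rule finite_subset[OF set_pmf_iid_list_subset])
     (use finite_lists_length_eq[OF assms, of k] in \<open>simp add: conj_commute\<close>)

lemma pmf_iid_list: "pmf (iid_list k p) xs = (if length xs = k then prod_list (map (pmf p) xs) else 0)"
proof (induction k arbitrary: xs)
  case 0
  then show ?case by (auto simp: pmf_return)
next
  case (Suc k)
  have eq: "iid_list (Suc k) p = map_pmf (\<lambda>(x, xs). x # xs) (pair_pmf p (iid_list k p))"
    by (simp add: pair_pmf_def map_bind_pmf)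
  show ?case
  proof (cases xs)
    case Nil
    have "[] \<notin> set_pmf (iid_list (Suc k) p)"
      using set_pmf_iid_list_subset[of "Suc k" p] by auto
    then show ?thesis using Nil by (simp add: pmf_eq_0_set_pmf)
  next
    case (Cons y ys)
    have inj: "inj (\<lambda>(x, xs). x # xs :: 'a list)" by (auto simp: inj_on_def)
    have "pmf (iid_list (Suc k) p) xs = pmf (pair_pmf p (iid_list k p)) (y, ys)"
      unfolding eq Cons using pmf_map_inj'[OF inj, of "pair_pmf p (iid_list k p)" "(y, ys)"] by simp
    then show ?thesis using Suc Cons by (simp add: pmf_pair)
  qed
qed

definition count_if :: "('a \<Rightarrow> bool) \<Rightarrow> 'a list \<Rightarrow> nat" where
  "count_if Q xs = length (filter Q xs)"

lemma count_if_le: "count_if Q xs \<le> length xs"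
  by (simp add: count_if_def)

lemma count_if_iid_list:
  "map_pmf (count_if Q) (iid_list k p) = binomial_pmf k (measure_pmf.prob p {x. Q x})"
proof (induction k)
  case 0
  then show ?case by (simp add: count_if_def binomial_pmf_0)
next
  case (Suc k)
  let ?r = "measure_pmf.prob p {x. Q x}"
  have Q: "map_pmf Q p = bernoulli_pmf ?r"
  proof (rule pmf_eqI)
    fix b
    have "pmf (map_pmf Q p) True = ?r"
      by (simp add: pmf_map vimage_def)
    moreover have "pmf (map_pmf Q p) False = 1 - ?r"
      using measure_pmf.prob_compl[of "{x. Q x}" p] by (simp add: pmf_map vimage_def Compl_eq_Diff_UNIV[symmetric] Collect_neg_eq)
    ultimately show "pmf (map_pmf Q p) b = pmf (bernoulli_pmf ?r) b"
      by (cases b) auto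
  qed
  have "map_pmf (count_if Q) (iid_list (Suc k) p)
      = map_pmf Q p \<bind> (\<lambda>b. map_pmf (count_if Q) (iid_list k p) \<bind> (\<lambda>j. return_pmf ((if b then 1 else 0) + j)))"
    by (simp add: map_bind_pmf bind_map_pmf count_if_def) (auto intro!: bind_pmf_cong)
  then show ?case
    unfolding Suc Q by (simp add: binomial_pmf_Suc)
qed

lemma expectation_binomial_pmf_exp_le:
  assumes p: "p \<in> {0..1}" and "\<kappa> \<ge> 0"
  shows "measure_pmf.expectation (binomial_pmf m p) (\<lambda>k. exp (- \<kappa> * real k))
           \<le> exp (- (real m * p * (1 - exp (-\<kappa>))))"
proof -
  have "measure_pmf.expectation (binomial_pmf m p) (\<lambda>k. exp (- \<kappa> * real k))
      = (\<Sum>k\<le>m. real (m choose k) * (p * exp (-\<kappa>)) ^ k * (1 - p) ^ (m - k))"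
    unfolding expectation_binomial_pmf'[OF p]
    by (intro sum.cong) (auto simp: power_mult_distrib exp_of_nat_mult[symmetric] mult_ac)
  also have "\<dots> = (p * exp (-\<kappa>) + (1 - p)) ^ m"
    by (simp add: binomial_ring)
  also have "\<dots> \<le> exp (- (p * (1 - exp (-\<kappa>)))) ^ m"
  proof (rule power_mono)
    show "p * exp (- \<kappa>) + (1 - p) \<le> exp (- (p * (1 - exp (- \<kappa>))))"
      using exp_ge_add_one_self[of "- (p * (1 - exp (-\<kappa>)))"] by (simp add: algebra_simps)
  qed (use p in auto)
  also have "\<dots> = exp (- (real m * p * (1 - exp (-\<kappa>))))"
    by (simp add: exp_of_nat_mult[symmetric] mult_ac)
  finally show ?thesis .
qed

lemma expectation_binomial_pmf_inverse_Suc_le: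
  assumes p: "p \<in> {0..1}" and "real m * p > 0"
  shows "measure_pmf.expectation (binomial_pmf m p) (\<lambda>k. 1 / (1 + real k)) \<le> 1 / (real m * p)"
proof -
  have pos: "p > 0" using assms by (auto simp: zero_less_mult_iff)
  have absorb: "real (m choose k) / (1 + real k) = real (Suc m choose Suc k) / (1 + real m)" for k
  proof -
    have "(1 + real k) * real (Suc m choose Suc k) = (1 + real m) * real (m choose k)"
      using Suc_times_binomial[of k m] by (metis of_nat_Suc of_nat_mult)
    then show ?thesis by (simp add: field_simps)
  qed
  have "measure_pmf.expectation (binomial_pmf m p) (\<lambda>k. 1 / (1 + real k))
      = (\<Sum>k\<le>m. (real (m choose k) / (1 + real k)) * p ^ k * (1 - p) ^ (m - k))"
    unfolding expectation_binomial_pmf'[OF p] by (intro sum.cong) (auto simp: divide_simps)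
  also have "\<dots> = (\<Sum>k\<le>m. real (Suc m choose Suc k) * p ^ Suc k * (1 - p) ^ (Suc m - Suc k)) / ((1 + real m) * p)"
    unfolding absorb sum_divide_distrib using pos by (intro sum.cong) (auto simp: divide_simps)
  also have "\<dots> \<le> 1 / ((1 + real m) * p)"
  proof (rule divide_right_mono)
    have "(\<Sum>k\<le>m. real (Suc m choose Suc k) * p ^ Suc k * (1 - p) ^ (Suc m - Suc k))
        \<le> (\<Sum>k\<le>Suc m. real (Suc m choose k) * p ^ k * (1 - p) ^ (Suc m - k))"
      unfolding sum.atMost_Suc_shift[of _ m] using p by simp
    also have "\<dots> = (p + (1 - p)) ^ Suc m" by (rule binomial_ring[symmetric])
    finally show "(\<Sum>k\<le>m. real (Suc m choose Suc k) * p ^ Suc k * (1 - p) ^ (Suc m - Suc k)) \<le> 1"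
      by simp
  qed (use pos in auto)
  also have "\<dots> \<le> 1 / (real m * p)"
    using assms pos by (intro frac_le) (auto simp: algebra_simps)
  finally show ?thesis .
qed

lemma prob_binomial_pmf_less_le:
  assumes p: "p \<in> {0..1}" and \<rho>: "\<rho> \<ge> 1" and mean: "p \<ge> \<rho> * \<gamma>"
  shows "measure_pmf.prob (binomial_pmf m p) {k. real k < \<gamma> * real m}
           \<le> exp (- (\<gamma> * real m * (\<rho> - 1 - ln \<rho>)))"
proof -
  let ?B = "binomial_pmf m p" and ?\<kappa> = "ln \<rho>"
  have \<kappa>: "?\<kappa> \<ge> 0" "exp (- ?\<kappa>) = 1 / \<rho>" using \<rho> by (auto simp: exp_minus field_simps)
  have "measure_pmf.prob ?B {k. real k < \<gamma> * real m}
      = measure_pmf.expectation ?B (indicator {k. real k < \<gamma> * real m})"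
    by simp
  also have "\<dots> \<le> measure_pmf.expectation ?B (\<lambda>k. exp (?\<kappa> * (\<gamma> * real m)) * exp (- ?\<kappa> * real k))"
  proof (rule integral_mono)
    fix k
    have "1 \<le> exp (?\<kappa> * (\<gamma> * real m)) * exp (- ?\<kappa> * real k)" if "real k < \<gamma> * real m"
      using that \<kappa>(1) by (simp add: exp_add[symmetric] mult_left_mono)
    then show "indicator {k. real k < \<gamma> * real m} k
        \<le> exp (?\<kappa> * (\<gamma> * real m)) * exp (- ?\<kappa> * real k)"
      by (simp add: indicator_def)
  qed (auto intro: integrable_binomial_pmf p)
  also have "\<dots> = exp (?\<kappa> * (\<gamma> * real m)) * measure_pmf.expectation ?B (\<lambda>k. exp (- ?\<kappa> * real k))"
    by simp
  also have "\<dots> \<le> exp (?\<kappa> * (\<gamma> * real m)) * exp (- (real m * p * (1 - exp (- ?\<kappa>))))"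
    by (intro mult_left_mono expectation_binomial_pmf_exp_le p \<kappa>) auto
  also have "\<dots> \<le> exp (?\<kappa> * (\<gamma> * real m)) * exp (- (real m * (\<rho> * \<gamma>) * (1 - 1 / \<rho>)))"
    unfolding \<kappa>(2) using mean \<rho> by (auto intro!: mult_right_mono mult_left_mono)
  also have "\<dots> = exp (- (\<gamma> * real m * (\<rho> - 1 - ln \<rho>)))"
    unfolding exp_add[symmetric] using \<rho> by (simp add: field_simps)
  finally show ?thesis .
qed

section \<open>Additive drift, mutation and selection\<close>

lemma set_pmf_trajectory:
  assumes "set_pmf P0 \<subseteq> I" and "\<And>P. P \<in> I \<Longrightarrow> set_pmf (step P) \<subseteq> I"
    and "xs \<in> set_pmf (trajectory P0 step t)"
  shows "xs \<noteq> [] \<and> last xs \<in> I"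
  using assms(3)
proof (induction t arbitrary: xs)
  case 0
  then show ?case using assms(1) by auto
next
  case (Suc t)
  then obtain ys P where "ys \<in> set_pmf (trajectory P0 step t)" "P \<in> set_pmf (step (last ys))" "xs = ys @ [P]"
    by auto
  then show ?case using Suc.IH assms(2) by auto
qed

lemma sum_not_found_prob_le:
  fixes V :: "population \<Rightarrow> real"
  assumes init: "set_pmf P0 \<subseteq> I" and step: "\<And>P. P \<in> I \<Longrightarrow> set_pmf (step P) \<subseteq> I"
    and fin: "\<And>P. P \<in> I \<Longrightarrow> finite (set_pmf (step P))"
    and nonneg: "\<And>P. V P \<ge> 0" and le: "\<And>P. P \<in> I \<Longrightarrow> V P \<le> B" and \<delta>: "\<delta> > 0"
    and drift: "\<And>P. P \<in> I \<Longrightarrow> \<forall>x\<in>set P. \<not> is_optimum n f x \<Longrightarrow>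
                  measure_pmf.expectation (step P) V \<le> V P - \<delta>"
  shows "(\<Sum>t<m. not_found_prob n f P0 step t) \<le> B / \<delta>"
proof -
  define NF where "NF = {xs. \<forall>P\<in>set xs. \<forall>x\<in>set P. \<not> is_optimum n f x}"
  define T where "T = trajectory P0 step"
  define U where "U t = (\<integral>\<^sup>+xs. indicator NF xs * ennreal (V (last xs)) \<partial>T t)" for t
  have inv: "xs \<noteq> [] \<and> last xs \<in> I" if "xs \<in> set_pmf (T t)" for xs t
    using set_pmf_trajectory[of P0 I step xs t] init step that unfolding T_def by blast
  have decrease: "U (Suc t) + ennreal \<delta> * emeasure (T t) NF \<le> U t" for t
  proof -
    have "U (Suc t) + ennreal \<delta> * emeasure (T t) NF
        = (\<integral>\<^sup>+xs. (\<integral>\<^sup>+P. indicator NF (xs @ [P]) * ennreal (V P) \<partial>step (last xs)) \<partial>T t)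
          + (\<integral>\<^sup>+xs. ennreal \<delta> * indicator NF xs \<partial>T t)"
      by (simp add: U_def T_def nn_integral_cmult)
    also have "\<dots> = (\<integral>\<^sup>+xs. (\<integral>\<^sup>+P. indicator NF (xs @ [P]) * ennreal (V P) \<partial>step (last xs))
          + ennreal \<delta> * indicator NF xs \<partial>T t)"
      by (rule nn_integral_add[symmetric]) auto
    also have "\<dots> \<le> (\<integral>\<^sup>+xs. indicator NF xs * ennreal (V (last xs)) \<partial>T t)"
    proof (rule nn_integral_mono_AE, unfold AE_measure_pmf_iff, rule ballI)
      fix xs assume xs: "xs \<in> set_pmf (T t)"
      show "(\<integral>\<^sup>+P. indicator NF (xs @ [P]) * ennreal (V P) \<partial>step (last xs)) + ennreal \<delta> * indicator NF xs
          \<le> indicator NF xs * ennreal (V (last xs))"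
      proof (cases "xs \<in> NF")
        case False
        then have "\<And>P. xs @ [P] \<notin> NF" by (auto simp: NF_def)
        then show ?thesis using False by simp
      next
        case True
        have I: "last xs \<in> I" and "xs \<noteq> []" using inv[OF xs] by auto
        then have nf: "\<forall>x\<in>set (last xs). \<not> is_optimum n f x" using True by (auto simp: NF_def)
        have "(\<integral>\<^sup>+P. indicator NF (xs @ [P]) * ennreal (V P) \<partial>step (last xs)) \<le> (\<integral>\<^sup>+P. ennreal (V P) \<partial>step (last xs))"
          by (intro nn_integral_mono) (auto simp: indicator_def)
        also have "\<dots> = ennreal (measure_pmf.expectation (step (last xs)) V)"
          by (rule nn_integral_eq_integral) (auto intro: integrable_measure_pmf_finite fin I nonneg)
        finally have "(\<integral>\<^sup>+P. indicator NF (xs @ [P]) * ennreal (V P) \<partial>step (last xs)) + ennreal \<delta>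
            \<le> ennreal (measure_pmf.expectation (step (last xs)) V) + ennreal \<delta>"
          by (rule add_right_mono)
        also have "\<dots> = ennreal (measure_pmf.expectation (step (last xs)) V + \<delta>)"
          using \<delta> nonneg by (intro ennreal_plus[symmetric]) (auto intro: integral_nonneg)
        also have "\<dots> \<le> ennreal (V (last xs))"
          using drift[OF I nf] by (intro ennreal_leI) simp
        finally show ?thesis using True by simp
      qed
    qed
    finally show ?thesis by (simp add: U_def)
  qed
  have "ennreal \<delta> * (\<Sum>t<m. emeasure (T t) NF) + U m \<le> U 0" for m
  proof (induction m)
    case (Suc m)
    have "ennreal \<delta> * (\<Sum>t<Suc m. emeasure (T t) NF) + U (Suc m)
        = ennreal \<delta> * (\<Sum>t<m. emeasure (T t) NF) + (U (Suc m) + ennreal \<delta> * emeasure (T m) NF)"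
      by (simp add: distrib_left add_ac)
    also have "\<dots> \<le> ennreal \<delta> * (\<Sum>t<m. emeasure (T t) NF) + U m"
      by (intro add_left_mono decrease)
    finally show ?case using Suc.IH by simp
  qed simp
  then have "ennreal \<delta> * (\<Sum>t<m. emeasure (T t) NF) \<le> U 0"
    by (meson le_iff_add order_trans)
  also have "\<dots> \<le> (\<integral>\<^sup>+xs. ennreal B \<partial>T 0)"
    unfolding U_def
    by (rule nn_integral_mono_AE, unfold AE_measure_pmf_iff)
       (auto simp: indicator_def intro!: ennreal_leI le dest: inv)
  also have "\<dots> = ennreal B" by simp
  also have "(\<Sum>t<m. emeasure (T t) NF) = ennreal (\<Sum>t<m. not_found_prob n f P0 step t)"
    by (simp add: measure_pmf.emeasure_eq_measure not_found_prob_def NF_def T_def)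
  finally have "ennreal (\<delta> * (\<Sum>t<m. not_found_prob n f P0 step t)) \<le> ennreal B"
    using \<delta> by (simp add: ennreal_mult sum_nonneg not_found_prob_def)
  moreover have "B \<ge> 0"
  proof -
    obtain P where "P \<in> I" using set_pmf_not_empty[of P0] init by blast
    then show ?thesis using le nonneg order_trans by blast
  qed
  ultimately show ?thesis using \<delta> by (simp add: field_simps)
qed

lemma expected_runtime_le:
  assumes lam: "lam > 0"
    and B: "\<And>m. (\<Sum>t<m. not_found_prob n f (init_pop n lam) step t) \<le> B"
  shows "expected_runtime n lam f step \<le> ennreal (real lam * B)"
proof -
  let ?q = "\<lambda>t. not_found_prob n f (init_pop n lam) step t"
  have q0: "?q t \<ge> 0" for t by (simp add: not_found_prob_def)
  have "(\<Sum>k<m. ennreal (?q (k div lam))) \<le> ennreal (real lam * B)" for m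
  proof -
    have "m \<le> m * lam" using lam by simp
    then have "(\<Sum>k<m. ?q (k div lam)) \<le> (\<Sum>k<m * lam. ?q (k div lam))"
      by (intro sum_mono2) (auto simp: q0)
    also have "\<dots> = (\<Sum>t<m. \<Sum>k = t * lam..<t * lam + lam. ?q (k div lam))"
      by (rule sum.nat_group[symmetric])
    also have "\<dots> = (\<Sum>t<m. real lam * ?q t)"
    proof (intro sum.cong refl)
      fix t
      have "(\<Sum>k = t * lam..<t * lam + lam. ?q (k div lam)) = (\<Sum>k = t * lam..<t * lam + lam. ?q t)"
      proof (intro sum.cong refl)
        fix k assume "k \<in> {t * lam..<t * lam + lam}"
        then have "k div lam = t" by (intro div_nat_eqI) (auto simp: mult.commute)
        then show "?q (k div lam) = ?q t" by simp
      qed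
      then show "(\<Sum>k = t * lam..<t * lam + lam. ?q (k div lam)) = real lam * ?q t" by simp
    qed
    also have "\<dots> \<le> real lam * B"
      unfolding sum_distrib_left[symmetric] by (intro mult_left_mono B) simp
    finally show ?thesis by (simp add: q0 ennreal_leI)
  qed
  then show ?thesis
    unfolding expected_runtime_def suminf_eq_SUP by (intro SUP_least)
qed

lemma linf_flip:
  assumes x: "length x = n" and S: "S \<subseteq> {i. i < n \<and> \<not> x ! i}"
  shows "linf a (map2 (\<lambda>b f. b \<noteq> f) x (map (\<lambda>i. i \<in> S) [0..<n])) = linf a x + sum a S"
proof -
  let ?y = "map2 (\<lambda>b f. b \<noteq> f) x (map (\<lambda>i. i \<in> S) [0..<n])"
  have "linf a ?y = (\<Sum>i<n. a i * (if x ! i \<noteq> (i \<in> S) then 1 else 0))"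
    unfolding linf_def using x by (intro sum.cong) auto
  also have "\<dots> = (\<Sum>i<n. a i * (if x ! i then 1 else 0) + (if i \<in> S then a i else 0))"
    using S by (intro sum.cong) auto
  also have "\<dots> = linf a x + (\<Sum>i<n. if i \<in> S then a i else 0)"
    using x by (simp add: sum.distrib linf_def)
  also have "(\<Sum>i<n. if i \<in> S then a i else 0) = sum a S"
    using S by (simp add: sum.If_cases) (intro arg_cong[of _ _ "sum a"]; auto)
  finally show ?thesis .
qed

lemma prob_mutate_ge:
  assumes x: "length x = n" and p: "chi / real n \<in> {0..1}"
    and Z: "Z \<subseteq> {i. i < n \<and> \<not> x ! i}"
    and gain: "\<And>S. S \<subseteq> Z \<Longrightarrow> card S = m \<Longrightarrow> F \<le> linf a x + sum a S"
  shows "real (card Z choose m) * ((chi / real n) ^ m * (1 - chi / real n) ^ (n - m))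
           \<le> measure_pmf.prob (mutate chi n x) {y. F \<le> linf a y}"
proof -
  let ?p = "chi / real n" and ?M = "iid_list n (bernoulli_pmf (chi / real n))"
  define mask where "mask S = map (\<lambda>i. i \<in> S) [0..<n]" for S
  define F' where "F' = {S. S \<subseteq> Z \<and> card S = m}"
  have fZ: "finite Z" using Z by (rule finite_subset) simp
  have fF: "finite F'" unfolding F'_def using fZ by (auto intro: finite_subset[of _ "Pow Z"])
  have inj: "inj_on mask F'"
  proof (rule inj_onI)
    fix S T assume ST: "S \<in> F'" "T \<in> F'" and eq: "mask S = mask T"
    have "i \<in> S \<longleftrightarrow> i \<in> T" if "i < n" for i
      using arg_cong[OF eq, of "\<lambda>l. l ! i"] that by (simp add: mask_def)
    then show "S = T" using ST Z unfolding F'_def by blast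
  qed
  have pmf_mask: "pmf ?M (mask S) = ?p ^ m * (1 - ?p) ^ (n - m)" if "S \<in> F'" for S
  proof -
    have S: "S \<subseteq> {..<n}" "card S = m" "finite S"
      using that Z fZ by (auto simp: F'_def intro: finite_subset)
    have "pmf ?M (mask S) = (\<Prod>i<n. if i \<in> S then ?p else 1 - ?p)"
      using p by (auto simp: pmf_iid_list mask_def prod.distinct_set_conv_list[symmetric] o_def
          atLeast0LessThan intro!: prod.cong)
    also have "\<dots> = ?p ^ card ({..<n} \<inter> S) * (1 - ?p) ^ card ({..<n} - S)"
      by (simp add: prod.If_cases Diff_eq)
    also have "\<dots> = ?p ^ m * (1 - ?p) ^ (n - m)"
      using S by (simp add: Int_absorb1 card_Diff_subset)
    finally show ?thesis .
  qed
  have "real (card Z choose m) * (?p ^ m * (1 - ?p) ^ (n - m)) = (\<Sum>S\<in>F'. pmf ?M (mask S))"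
    using n_subsets[OF fZ, of m] by (simp add: pmf_mask F'_def[symmetric])
  also have "\<dots> = measure_pmf.prob ?M (mask ` F')"
    using fF inj by (simp add: measure_measure_pmf_finite sum.reindex)
  also have "\<dots> \<le> measure_pmf.prob ?M ((\<lambda>fl. map2 (\<lambda>b f. b \<noteq> f) x fl) -` {y. F \<le> linf a y})"
  proof (rule measure_pmf.finite_measure_mono)
    show "mask ` F' \<subseteq> (\<lambda>fl. map2 (\<lambda>b f. b \<noteq> f) x fl) -` {y. F \<le> linf a y}"
    proof (intro image_subsetI vimageI2 CollectI)
      fix S assume "S \<in> F'"
      then have S: "S \<subseteq> Z" "card S = m" by (auto simp: F'_def)
      then have "linf a (map2 (\<lambda>b f. b \<noteq> f) x (mask S)) = linf a x + sum a S"
        unfolding mask_def using Z by (intro linf_flip x) auto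
      then show "F \<le> linf a (map2 (\<lambda>b f. b \<noteq> f) x (mask S))" using gain[OF S] by simp
    qed
  qed simp
  also have "\<dots> = measure_pmf.prob (mutate chi n x) {y. F \<le> linf a y}"
    by (simp add: mutate_def x)
  finally show ?thesis .
qed

lemma set_pmf_mutate_subset: "set_pmf (mutate chi n x) \<subseteq> {y. length y = length x}"
  unfolding mutate_def using set_pmf_iid_list_subset[of "length x" "bernoulli_pmf (chi / real n)"] by auto

lemma finite_length_eq_bits: "finite {x :: bits. length x = n}"
  using finite_lists_length_eq[of "UNIV :: bool set" n] by simp

lemma finite_set_pmf_mutate: "finite (set_pmf (mutate chi n x))"
  by (rule finite_subset[OF set_pmf_mutate_subset finite_length_eq_bits])

definition sel_prob :: "(bits \<Rightarrow> real) \<Rightarrow> population \<Rightarrow> (bits \<Rightarrow> bool) \<Rightarrow> real" where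
  "sel_prob g P Q = (\<Sum>i | i < length P \<and> Q (P ! i). g (P ! i)) / (\<Sum>j<length P. g (P ! j))"

context
  fixes g :: "bits \<Rightarrow> real" and P :: population
  assumes P: "P \<noteq> []" and g: "\<And>x. g x > 0"
begin

lemma sum_fitness_pos: "(\<Sum>j<length P. g (P ! j)) > 0"
  using P g by (intro sum_pos) auto

lemma fitness_share_nonneg: "0 \<le> g x / (\<Sum>j<length P. g (P ! j))"
  using sum_fitness_pos g[of x] by simp

lemma fp_select_wf:
  "pmf_of_list_wf (map (\<lambda>i. (i, g (P ! i) / (\<Sum>j<length P. g (P ! j)))) [0..<length P])"
proof (rule pmf_of_list_wfI)
  show "sum_list (map snd (map (\<lambda>i. (i, g (P ! i) / (\<Sum>j<length P. g (P ! j)))) [0..<length P])) = 1"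
    using sum_fitness_pos
    by (simp add: o_def sum.distinct_set_conv_list[symmetric] sum_divide_distrib[symmetric] atLeast0LessThan)
qed (use fitness_share_nonneg in auto)

lemma set_pmf_fp_select: "set_pmf (fp_select g P) \<subseteq> {..<length P}"
  unfolding fp_select_def using set_pmf_of_list[OF fp_select_wf] by auto

lemma pmf_fp_select:
  assumes "i < length P"
  shows "pmf (fp_select g P) i = g (P ! i) / (\<Sum>j<length P. g (P ! j))"
proof -
  let ?Z = "\<Sum>j<length P. g (P ! j)"
  have "pmf (fp_select g P) i = sum_list (map (\<lambda>j. if j = i then g (P ! j) / ?Z else 0) [0..<length P])"
    unfolding fp_select_def pmf_pmf_of_list[OF fp_select_wf]
    by (simp add: sum_list_map_filter' o_def cong: if_cong)
  also have "\<dots> = (\<Sum>j\<in>set [0..<length P]. if j = i then g (P ! j) / ?Z else 0)"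
    by (rule sum.distinct_set_conv_list[symmetric]) simp
  also have "\<dots> = g (P ! i) / ?Z" using assms by (subst sum.delta) auto
  finally show ?thesis .
qed

lemma prob_offspring_ge:
  assumes fin: "\<And>x. finite (set_pmf (mut x))"
    and r: "\<And>x. x \<in> set P \<Longrightarrow> Q x \<Longrightarrow> r \<le> measure_pmf.prob (mut x) A"
  shows "r * sel_prob g P Q \<le> measure_pmf.prob (fp_select g P \<bind> (\<lambda>i. mut (P ! i))) A"
proof -
  let ?Z = "\<Sum>j<length P. g (P ! j)"
  have "r * sel_prob g P Q = (\<Sum>i | i < length P \<and> Q (P ! i). g (P ! i) / ?Z * r)"
    by (simp add: sel_prob_def sum_divide_distrib sum_distrib_left mult_ac)
  also have "\<dots> \<le> (\<Sum>i | i < length P \<and> Q (P ! i). g (P ! i) / ?Z * measure_pmf.prob (mut (P ! i)) A)"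
    by (intro sum_mono mult_left_mono fitness_share_nonneg) (simp add: r)
  also have "\<dots> \<le> (\<Sum>i<length P. g (P ! i) / ?Z * measure_pmf.prob (mut (P ! i)) A)"
    by (intro sum_mono2 mult_nonneg_nonneg fitness_share_nonneg) auto
  also have "\<dots> = measure_pmf.expectation (fp_select g P \<bind> (\<lambda>i. mut (P ! i))) (indicator A)"
    by (subst pmf_expectation_bind[of "{..<length P}"])
       (simp_all add: fin set_pmf_fp_select pmf_fp_select)
  finally show ?thesis by simp
qed

end

lemma sel_prob_power:
  fixes c \<epsilon> :: real and f :: "bits \<Rightarrow> nat"
  assumes c: "c > 1" and \<epsilon>: "\<epsilon> > 0" and P: "P \<noteq> []"
  shows sel_prob_power_ge: "\<epsilon> / c * real (length P) \<le> real (count_if (\<lambda>x. M \<le> f x) P) \<Longrightarrow>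
           \<epsilon> / (1 + \<epsilon>) \<le> sel_prob (\<lambda>x. c ^ f x) P (\<lambda>x. M \<le> f x)" (is "?many \<Longrightarrow> ?half")
    and sel_prob_power_cases: "\<epsilon> / (1 + \<epsilon>) \<le> sel_prob (\<lambda>x. c ^ f x) P (\<lambda>x. M \<le> f x) \<or>
           real (count_if (\<lambda>x. M + h \<le> f x) P) / real (length P) * c ^ Suc h / (1 + \<epsilon>)
             \<le> sel_prob (\<lambda>x. c ^ f x) P (\<lambda>x. M + h \<le> f x)" (is "_ \<or> ?grow")
proof -
  let ?l = "real (length P)"
  define S where "S N = (\<Sum>i | i < length P \<and> N \<le> f (P ! i). c ^ f (P ! i))" for N
  define L where "L = (\<Sum>i | i < length P \<and> \<not> M \<le> f (P ! i). c ^ f (P ! i))"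
  define Z where "Z = (\<Sum>i<length P. c ^ f (P ! i))"
  have sel: "sel_prob (\<lambda>x. c ^ f x) P (\<lambda>x. N \<le> f x) = S N / Z" for N
    by (simp add: sel_prob_def S_def Z_def)
  have l: "?l > 0" using P by simp
  have Zpos: "Z > 0" unfolding Z_def using P c by (intro sum_pos) auto
  have SZ: "Z = S M + L"
    unfolding Z_def S_def L_def
    by (subst sum.union_disjoint[symmetric]) (auto intro!: sum.cong)
  have S_ge: "real (count_if (\<lambda>x. N \<le> f x) P) * c ^ N \<le> S N" for N
  proof -
    have "real (count_if (\<lambda>x. N \<le> f x) P) * c ^ N = (\<Sum>i | i < length P \<and> N \<le> f (P ! i). c ^ N)"
      by (simp add: count_if_def length_filter_conv_card)
    also have "\<dots> \<le> S N" unfolding S_def using c by (intro sum_mono power_increasing) auto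
    finally show ?thesis .
  qed
  have L_le: "L \<le> ?l * (c ^ M / c)"
  proof -
    have "L \<le> (\<Sum>i | i < length P \<and> \<not> M \<le> f (P ! i). c ^ M / c)"
      unfolding L_def
    proof (rule sum_mono)
      fix i assume "i \<in> {i. i < length P \<and> \<not> M \<le> f (P ! i)}"
      then have "c ^ Suc (f (P ! i)) \<le> c ^ M" using c by (intro power_increasing) auto
      then show "c ^ f (P ! i) \<le> c ^ M / c" using c by (simp add: field_simps)
    qed
    also have "\<dots> = real (card {i. i < length P \<and> \<not> M \<le> f (P ! i)}) * (c ^ M / c)" by simp
    also have "\<dots> \<le> ?l * (c ^ M / c)"
      using c card_mono[of "{..<length P}" "{i. i < length P \<and> \<not> M \<le> f (P ! i)}"]
      by (intro mult_right_mono) auto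
    finally show ?thesis .
  qed
  have iff: "\<epsilon> / (1 + \<epsilon>) \<le> S M / Z \<longleftrightarrow> \<epsilon> * L \<le> S M"
    using Zpos \<epsilon> unfolding SZ by (simp add: field_simps)
  show ?half if ?many
  proof -
    have "\<epsilon> * L \<le> \<epsilon> * (?l * (c ^ M / c))" using L_le \<epsilon> by (intro mult_left_mono) auto
    also have "\<dots> = (\<epsilon> / c * ?l) * c ^ M" by simp
    also have "\<dots> \<le> real (count_if (\<lambda>x. M \<le> f x) P) * c ^ M"
      using that c by (intro mult_right_mono) auto
    also have "\<dots> \<le> S M" by (rule S_ge)
    finally show ?thesis unfolding sel iff .
  qed
  show "?half \<or> ?grow"
  proof (cases ?half)
    case False
    then have "S M < \<epsilon> * L" unfolding sel iff by simp
    then have "Z \<le> (1 + \<epsilon>) * L" by (simp add: SZ algebra_simps)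
    also have "\<dots> \<le> (1 + \<epsilon>) * (?l * (c ^ M / c))" using L_le \<epsilon> by (intro mult_left_mono) auto
    finally have Z_le: "Z \<le> (1 + \<epsilon>) * (?l * (c ^ M / c))" .
    let ?k = "real (count_if (\<lambda>x. M + h \<le> f x) P)"
    have "?k / ?l * c ^ Suc h / (1 + \<epsilon>) = ?k * c ^ (M + h) / ((1 + \<epsilon>) * (?l * (c ^ M / c)))"
      using c \<epsilon> l by (simp add: divide_simps power_add)
    also have "\<dots> \<le> ?k * c ^ (M + h) / Z"
      using Z_le Zpos c \<epsilon> l by (intro divide_left_mono mult_pos_pos) auto
    also have "\<dots> \<le> S (M + h) / Z"
      using S_ge[of "M + h"] Zpos by (intro divide_right_mono) auto
    finally show ?thesis unfolding sel by simp
  qed simp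
qed

section \<open>The potential of a single level\<close>

definition level_cost :: "real \<Rightarrow> real \<Rightarrow> real \<Rightarrow> nat \<Rightarrow> nat \<Rightarrow> real" where
  "level_cost a W \<kappa> m k = 1 + a * (ln (1 + real m) - ln (1 + real k)) + W * exp (- \<kappa> * real k)"

text \<open>Conditions for drift \<open>- 1\<close> when the count is binomial with mean at least \<open>R * k\<close> and at least \<open>y\<close>:
  at \<open>k = 0\<close> it comes from the exponential term, at \<open>k \<ge> 1\<close> from both; \<open>r\<close> is the point at which the
  logarithm is linearised.\<close>

definition admissible_cost :: "real \<Rightarrow> real \<Rightarrow> real \<Rightarrow> real \<Rightarrow> real \<Rightarrow> bool" where
  "admissible_cost R y a W \<kappa> \<longleftrightarrow> R > 0 \<and> a \<ge> 0 \<and> W \<ge> 0 \<and> \<kappa> \<ge> 0 \<and>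
     1 \<le> W * (1 - exp (- y * (1 - exp (-\<kappa>)))) \<and>
     (\<forall>k::nat. k \<ge> 1 \<longrightarrow> (\<exists>r>0. 1 \<le> a * (ln r + 1 - r * ((1 + real k) / (R * real k)))
        + W * (exp (- \<kappa> * real k) - exp (- (R * real k * (1 - exp (-\<kappa>)))))))"

lemma expectation_binomial_pmf_ln_ge:
  assumes p: "p \<in> {0..1}" and mean: "real m * p \<ge> \<mu>" and \<mu>: "\<mu> > 0" and t: "t > 0" and r: "r > 0"
  shows "ln t + ln r + 1 - r * (t / \<mu>) \<le> measure_pmf.expectation (binomial_pmf m p) (\<lambda>k. ln (1 + real k))"
proof -
  let ?E = "measure_pmf.expectation (binomial_pmf m p)"
  have "?E (\<lambda>k. 1 / (1 + real k)) \<le> 1 / (real m * p)"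
    using mean \<mu> by (intro expectation_binomial_pmf_inverse_Suc_le p) auto
  also have "\<dots> \<le> 1 / \<mu>" using mean \<mu> by (intro divide_left_mono) auto
  finally have inv: "?E (\<lambda>k. 1 / (1 + real k)) \<le> 1 / \<mu>" .
  have "ln t + ln r + 1 - r * (t / \<mu>) \<le> ln t + ln r + 1 - r * t * ?E (\<lambda>k. 1 / (1 + real k))"
    using mult_left_mono[OF inv, of "r * t"] r t by simp
  also have "\<dots> = ?E (\<lambda>k. ln t + ln r + 1 - r * t * (1 / (1 + real k)))"
    by (subst Bochner_Integration.integral_diff)
       (auto intro: integrable_binomial_pmf p simp del: times_divide_eq_right)
  also have "\<dots> \<le> ?E (\<lambda>k. ln (1 + real k))"
  proof (rule integral_mono)
    fix k
    have "ln (r * t / (1 + real k)) \<le> r * t / (1 + real k) - 1"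
      using r t by (intro ln_le_minus_one) auto
    then show "ln t + ln r + 1 - r * t * (1 / (1 + real k)) \<le> ln (1 + real k)"
      using r t by (simp add: ln_div ln_mult)
  qed (auto intro: integrable_binomial_pmf p)
  finally show ?thesis .
qed

lemma level_cost_ge_1: "k \<le> m \<Longrightarrow> a \<ge> 0 \<Longrightarrow> W \<ge> 0 \<Longrightarrow> 1 \<le> level_cost a W \<kappa> m k"
  by (simp add: level_cost_def)

lemma level_cost_antimono:
  assumes "a \<ge> 0" "W \<ge> 0" "\<kappa> \<ge> 0" "j \<le> k"
  shows "level_cost a W \<kappa> m k \<le> level_cost a W \<kappa> m j"
proof -
  have "\<kappa> * real j \<le> \<kappa> * real k" using assms by (intro mult_left_mono) auto
  then show ?thesis unfolding level_cost_def using assms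
    by (intro add_mono mult_left_mono diff_mono) auto
qed

lemma expectation_level_cost_le:
  assumes p: "p \<in> {0..1}" and adm: "admissible_cost R y a W \<kappa>"
    and mean: "R * real k \<le> real m * p"
  shows expectation_level_cost_nonincreasing:
      "measure_pmf.expectation (binomial_pmf m p) (level_cost a W \<kappa> m) \<le> level_cost a W \<kappa> m k"
    and expectation_level_cost_decreasing: "y \<le> real m * p \<Longrightarrow>
      measure_pmf.expectation (binomial_pmf m p) (level_cost a W \<kappa> m) \<le> level_cost a W \<kappa> m k - 1"
proof -
  let ?E = "measure_pmf.expectation (binomial_pmf m p)"
  have R: "R > 0" and a: "a \<ge> 0" and W: "W \<ge> 0" and \<kappa>: "\<kappa> \<ge> 0"
    and W1: "1 \<le> W * (1 - exp (- y * (1 - exp (-\<kappa>))))"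
    using adm by (auto simp: admissible_cost_def)
  have integrable: "integrable (binomial_pmf m p) f" for f :: "nat \<Rightarrow> real"
    by (rule integrable_binomial_pmf[OF p])
  have E: "?E (level_cost a W \<kappa> m) = 1 + a * (ln (1 + real m) - ?E (\<lambda>k. ln (1 + real k)))
      + W * ?E (\<lambda>k. exp (- \<kappa> * real k))"
    unfolding level_cost_def by (simp add: integrable algebra_simps)
  have exp_le: "?E (\<lambda>k. exp (- \<kappa> * real k)) \<le> exp (- (\<mu> * (1 - exp (-\<kappa>))))" if "\<mu> \<le> real m * p" for \<mu>
  proof -
    have "?E (\<lambda>k. exp (- \<kappa> * real k)) \<le> exp (- (real m * p * (1 - exp (-\<kappa>))))"
      by (rule expectation_binomial_pmf_exp_le[OF p \<kappa>])
    also have "\<dots> \<le> exp (- (\<mu> * (1 - exp (-\<kappa>))))"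
      using that \<kappa> by (auto intro: mult_right_mono)
    finally show ?thesis .
  qed
  have pos: "?E (level_cost a W \<kappa> m) \<le> level_cost a W \<kappa> m k - 1" if k: "k \<ge> 1"
  proof -
    obtain r where r: "r > 0" and step: "1 \<le> a * (ln r + 1 - r * ((1 + real k) / (R * real k)))
        + W * (exp (- \<kappa> * real k) - exp (- (R * real k * (1 - exp (-\<kappa>)))))"
      using adm k unfolding admissible_cost_def by blast
    have ln: "ln (1 + real k) + ln r + 1 - r * ((1 + real k) / (R * real k)) \<le> ?E (\<lambda>k. ln (1 + real k))"
      using k R r mean by (intro expectation_binomial_pmf_ln_ge p) auto
    show ?thesis
      unfolding E level_cost_def
      using mult_left_mono[OF ln a] mult_left_mono[OF exp_le[OF mean] W] step
      by (simp add: algebra_simps)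
  qed
  have anti: "?E (level_cost a W \<kappa> m) \<le> level_cost a W \<kappa> m 0"
  proof -
    have "?E (level_cost a W \<kappa> m) \<le> ?E (\<lambda>_. level_cost a W \<kappa> m 0)"
      using a W \<kappa> by (intro integral_mono integrable level_cost_antimono) auto
    then show ?thesis by simp
  qed
  show "?E (level_cost a W \<kappa> m) \<le> level_cost a W \<kappa> m k"
  proof (cases "k = 0")
    case True
    then show ?thesis using anti by simp
  next
    case False
    then show ?thesis using pos by simp
  qed
  show "?E (level_cost a W \<kappa> m) \<le> level_cost a W \<kappa> m k - 1" if y: "y \<le> real m * p"
  proof (cases "k = 0")
    case True
    have "?E (\<lambda>k. ln (1 + real k)) \<ge> 0" by (intro Bochner_Integration.integral_nonneg) auto
    then have "a * ?E (\<lambda>k. ln (1 + real k)) \<ge> 0" using a by simp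
    then show ?thesis
      unfolding E level_cost_def True
      using mult_left_mono[OF exp_le[OF y] W] W1 by (simp add: algebra_simps)
  next
    case False
    then show ?thesis using pos by simp
  qed
qed

lemma inverse_one_minus_exp_le:
  fixes x :: real
  assumes "x > 0"
  shows "1 \<le> (1 + 1 / x) * (1 - exp (- x))"
proof -
  have "(1 + x) * exp (- x) \<le> exp x * exp (- x)"
    using exp_ge_add_one_self[of x] by (intro mult_right_mono) auto
  then have "(1 + x) * exp (- x) \<le> 1" by (simp add: exp_minus)
  then show ?thesis using assms by (simp add: field_simps)
qed

lemma admissible_cost_fast:
  assumes R: "R \<ge> 2" and a: "1 \<le> a * ln (R / 2)" "a \<ge> 0" and y: "y > 0"
  shows "admissible_cost R y a (1 + 2 / y) 1"
proof -
  have e: "exp (-1) \<le> (1/2 :: real)"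
    using exp_ge_add_one_self[of 1] by (simp add: exp_minus field_simps)
  have W: "1 \<le> (1 + 2 / y) * (1 - exp (- y * (1 - exp (- 1))))"
  proof -
    let ?x = "y * (1 - exp (-1))"
    have x: "?x > 0" using y by simp
    have "1 \<le> (1 + 1 / ?x) * (1 - exp (- ?x))" by (rule inverse_one_minus_exp_le[OF x])
    also have "\<dots> \<le> (1 + 2 / y) * (1 - exp (- ?x))"
    proof (rule mult_right_mono)
      have "1 / ?x \<le> 1 / (y * (1 / 2))" using y e by (intro divide_left_mono mult_left_mono) auto
      then show "1 + 1 / ?x \<le> 1 + 2 / y" by simp
    qed (use x in simp)
    finally show ?thesis by simp
  qed
  have "1 \<le> a * (ln (R / 2) + 1 - R / 2 * ((1 + real k) / (R * real k)))
        + (1 + 2 / y) * (exp (- 1 * real k) - exp (- (R * real k * (1 - exp (-1)))))" if k: "k \<ge> 1" for k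
  proof -
    have "R / 2 * ((1 + real k) / (R * real k)) \<le> 1" using R k by (simp add: field_simps)
    then have "a * ln (R / 2) \<le> a * (ln (R / 2) + 1 - R / 2 * ((1 + real k) / (R * real k)))"
      using a(2) by (intro mult_left_mono) auto
    moreover have "1 * real k \<le> (R * (1 - exp (-1))) * real k"
    proof (rule mult_right_mono)
      have "2 * (1 / 2) \<le> R * (1 - exp (-1))" using R e by (intro mult_mono) auto
      then show "1 \<le> R * (1 - exp (-1))" by simp
    qed simp
    then have "exp (- (R * real k * (1 - exp (-1)))) \<le> exp (- 1 * real k)" by (simp add: mult_ac)
    then have "(1 + 2 / y) * (exp (- 1 * real k) - exp (- (R * real k * (1 - exp (-1))))) \<ge> 0"
      using y by (intro mult_nonneg_nonneg) auto
    ultimately show ?thesis using a(1) by linarith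
  qed
  moreover have "R / 2 > 0" "R > 0" using R by auto
  ultimately show ?thesis
    unfolding admissible_cost_def using a(2) W y by (auto intro!: exI[of _ "R / 2"])
qed

lemma admissible_cost_slow:
  fixes R :: real
  assumes R: "R > 1"
  obtains a w v \<kappa> where "a > 0" "w \<ge> 0" "v \<ge> 0" "\<And>y. y > 0 \<Longrightarrow> admissible_cost R y a (w + v / y) \<kappa>"
proof -
  define \<kappa> where "\<kappa> = (R - 1) / 2"
  define a where "a = 2 * R / (R - 1)"
  define d where "d = exp (-1) * (1 - exp (- (\<kappa> * ((R - 1) / (R + 1)))))"
  define w where "w = 1 + (1 + a) / d"
  define v where "v = 1 / (1 - exp (-\<kappa>))"
  have \<kappa>: "\<kappa> > 0" and a: "a > 0" using R by (auto simp: \<kappa>_def a_def)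
  have d: "d > 0" using R \<kappa> by (auto simp: d_def)
  have w: "w \<ge> 1" "w * d \<ge> 1 + a" using a d by (auto simp: w_def field_simps)
  have v: "v > 0" using \<kappa> by (auto simp: v_def)
  have shrink: "\<kappa> * (2 * R / (R + 1)) \<le> R * (1 - exp (-\<kappa>))"
  proof -
    have "1 \<le> (1 + 1 / \<kappa>) * (1 - exp (-\<kappa>))" by (rule inverse_one_minus_exp_le[OF \<kappa>])
    then have "\<kappa> / (1 + \<kappa>) \<le> 1 - exp (-\<kappa>)" using \<kappa> by (simp add: field_simps)
    then have "R * (\<kappa> / (1 + \<kappa>)) \<le> R * (1 - exp (-\<kappa>))" using R by (intro mult_left_mono) auto
    moreover have "R * (\<kappa> / (1 + \<kappa>)) = \<kappa> * (2 * R / (R + 1))"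
    proof -
      have eq: "1 + \<kappa> = (R + 1) / 2" by (simp add: \<kappa>_def field_simps)
      show ?thesis unfolding eq using R by (simp add: field_simps)
    qed
    ultimately show ?thesis by simp
  qed
  have adm: "admissible_cost R y a (w + v / y) \<kappa>" if y: "y > 0" for y
  proof -
    let ?W = "w + v / y"
    have vy: "v / y > 0" using v y by simp
    have W: "1 \<le> ?W * (1 - exp (- y * (1 - exp (-\<kappa>))))"
    proof -
      let ?x = "y * (1 - exp (-\<kappa>))"
      have x: "?x > 0" using y \<kappa> by simp
      have "1 \<le> (1 + 1 / ?x) * (1 - exp (- ?x))" by (rule inverse_one_minus_exp_le[OF x])
      also have "\<dots> \<le> ?W * (1 - exp (- ?x))"
        using w x by (intro mult_right_mono) (auto simp: v_def mult.commute)
      finally show ?thesis by simp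
    qed
    have "1 \<le> a * (ln 1 + 1 - 1 * ((1 + real k) / (R * real k)))
        + ?W * (exp (- \<kappa> * real k) - exp (- (R * real k * (1 - exp (-\<kappa>)))))" if k: "k \<ge> 1" for k
    proof -
      have "\<kappa> * (2 * R / (R + 1)) * real k \<le> R * (1 - exp (-\<kappa>)) * real k"
        using shrink by (rule mult_right_mono) simp
      then have "exp (- (R * real k * (1 - exp (-\<kappa>)))) \<le> exp (- (\<kappa> * (2 * R / (R + 1)) * real k))"
        by (simp add: mult_ac)
      also have "\<kappa> * (2 * R / (R + 1)) * real k = \<kappa> * real k + \<kappa> * real k * ((R - 1) / (R + 1))"
        using R by (simp add: field_simps)
      also have "exp (- (\<kappa> * real k + \<kappa> * real k * ((R - 1) / (R + 1))))
          = exp (- \<kappa> * real k) * exp (- (\<kappa> * real k * ((R - 1) / (R + 1))))"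
        by (simp add: exp_add[symmetric])
      finally have diff: "exp (- \<kappa> * real k) * (1 - exp (- (\<kappa> * real k * ((R - 1) / (R + 1)))))
          \<le> exp (- \<kappa> * real k) - exp (- (R * real k * (1 - exp (-\<kappa>))))"
        by (simp add: algebra_simps)
      have diff0: "0 \<le> exp (- \<kappa> * real k) * (1 - exp (- (\<kappa> * real k * ((R - 1) / (R + 1)))))"
        using \<kappa> R by auto
      show ?thesis
      proof (cases "\<kappa> * real k \<ge> 1")
        case True
        then have "(R - 1) * real k \<ge> 2" by (simp add: \<kappa>_def)
        then have "R * (real k + 2) \<le> R * (R * real k)"
          using R by (intro mult_left_mono) (auto simp: algebra_simps)
        then have "(R - 1) / (2 * R) \<le> 1 - (1 + real k) / (R * real k)"
          using R k by (simp add: field_simps)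
        then have "a * ((R - 1) / (2 * R)) \<le> a * (1 - (1 + real k) / (R * real k))"
          using a by (intro mult_left_mono) auto
        moreover have "a * ((R - 1) / (2 * R)) = 1" using R by (simp add: a_def)
        moreover have "0 \<le> ?W * (exp (- \<kappa> * real k) - exp (- (R * real k * (1 - exp (-\<kappa>)))))"
          using order_trans[OF diff0 diff] w vy by (intro mult_nonneg_nonneg) linarith+
        ultimately have "1 \<le> a * (1 - (1 + real k) / (R * real k))
            + ?W * (exp (- \<kappa> * real k) - exp (- (R * real k * (1 - exp (-\<kappa>)))))"
          by linarith
        then show ?thesis by simp
      next
        case False
        have "d \<le> exp (- \<kappa> * real k) * (1 - exp (- (\<kappa> * real k * ((R - 1) / (R + 1)))))"
          unfolding d_def
        proof (rule mult_mono)
          have "\<kappa> * 1 * ((R - 1) / (R + 1)) \<le> \<kappa> * real k * ((R - 1) / (R + 1))"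
            using \<kappa> R k by (intro mult_right_mono mult_left_mono) auto
          then show "1 - exp (- (\<kappa> * ((R - 1) / (R + 1)))) \<le> 1 - exp (- (\<kappa> * real k * ((R - 1) / (R + 1))))"
            by simp
        qed (use False \<kappa> R in auto)
        then have "d \<le> exp (- \<kappa> * real k) - exp (- (R * real k * (1 - exp (-\<kappa>))))"
          using diff by linarith
        then have "w * d \<le> ?W * (exp (- \<kappa> * real k) - exp (- (R * real k * (1 - exp (-\<kappa>)))))"
          using w vy d by (intro mult_mono) auto
        moreover have "(1 + real k) / (R * real k) \<le> 2"
        proof -
          have "1 * real k \<le> R * real k" using R by (intro mult_right_mono) auto
          then have "1 + real k \<le> 2 * (R * real k)" using k by linarith
          moreover have "0 < R * real k" using k R by simp
          ultimately show ?thesis by (simp only: pos_divide_le_eq)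
        qed
        then have "a * (-1) \<le> a * (1 - (1 + real k) / (R * real k))"
          using a by (intro mult_left_mono) auto
        ultimately show ?thesis using w by simp
      qed
    qed
    then show ?thesis
      unfolding admissible_cost_def using R a W w vy \<kappa> by (auto intro!: exI[of _ 1])
  qed
  show ?thesis using that[of a w v \<kappa>] a w v adm by auto
qed

section \<open>Improvements of linear functions\<close>

lemma linf_add_zeros:
  assumes "length x = n"
  shows "linf a x + sum a {i. i < n \<and> \<not> x ! i} = sum a {..<n}"
proof -
  have "linf a x = sum a {i. i < n \<and> x ! i}"
    unfolding linf_def using assms by (auto simp: if_distrib sum.If_cases intro!: sum.cong)
  moreover have "{..<n} = {i. i < n \<and> x ! i} \<union> {i. i < n \<and> \<not> x ! i}" by auto
  then have "sum a {..<n} = sum a {i. i < n \<and> x ! i} + sum a {i. i < n \<and> \<not> x ! i}"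
    by (simp only:) (rule sum.union_disjoint; auto)
  ultimately show ?thesis by simp
qed

lemma zero_in_prefix:
  assumes "length x = n" "i < n" "linf a x < sum a {..<Suc i}"
  obtains l where "l \<le> i" "\<not> x ! l"
proof -
  have "\<exists>l\<le>i. \<not> x ! l"
  proof (rule ccontr)
    assume "\<not> ?thesis"
    then have "sum a {..<Suc i} = (\<Sum>l<Suc i. a l * (if x ! l then 1 else 0))"
      by (intro sum.cong) auto
    also have "\<dots> \<le> linf a x"
      unfolding linf_def using assms by (intro sum_mono2) auto
    finally show False using assms by simp
  qed
  then show ?thesis using that by blast
qed

context
  fixes chi :: real and n :: nat
  assumes rate: "0 < chi" "2 * chi \<le> real n"
begin

lemma rate_bounds: "chi / real n \<in> {0..1}" "1 / 2 \<le> 1 - chi / real n" "n > 0"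
  using rate by (auto simp: field_simps)

lemma prob_mutate_stay:
  assumes "length x = n" "F \<le> linf a x"
  shows "(1 - chi / real n) ^ n \<le> measure_pmf.prob (mutate chi n x) {y. F \<le> linf a y}"
  using prob_mutate_ge[OF assms(1) rate_bounds(1), of "{}" 0 F a] assms by simp

lemma prob_mutate_flip:
  assumes "length x = n" "i < n" "\<not> x ! i" "F \<le> linf a x + a i"
  shows "chi / real n * (1 - chi / real n) ^ (n - 1) \<le> measure_pmf.prob (mutate chi n x) {y. F \<le> linf a y}"
proof -
  have "F \<le> linf a x + sum a S" if "S \<subseteq> {i}" "card S = 1" for S
    using that assms(4) by (cases "S = {i}") (auto simp: subset_singleton_iff)
  then show ?thesis
    using prob_mutate_ge[OF assms(1) rate_bounds(1), of "{i}" 1 F a] assms by simp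
qed

lemma flip_le_stay: "chi / real n * (1 - chi / real n) ^ (n - 1) \<le> (1 - chi / real n) ^ n"
proof -
  have "chi / real n \<le> 1 - chi / real n" using rate_bounds(2) by linarith
  then have "chi / real n * (1 - chi / real n) ^ (n - 1) \<le> (1 - chi / real n) * (1 - chi / real n) ^ (n - 1)"
    using rate_bounds by (intro mult_right_mono) auto
  also have "\<dots> = (1 - chi / real n) ^ n"
    using rate_bounds(3) by (simp add: power_eq_if)
  finally show ?thesis .
qed

text \<open>Either some zero bit is heavy and flipping it suffices, or there are linearly many zero bits,
  so that flipping \<open>3 * h\<close> of them at once has constant probability.\<close>

lemma prob_mutate_big_gain:
  fixes h A :: nat
  assumes x: "length x = n" and pos_a: "\<And>i. i < n \<Longrightarrow> a i > 0" and h: "h \<ge> 1" and A: "A \<ge> 1"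
    and far: "n \<le> A * (sum a {..<n} - D)" and less: "linf a x < D + h"
    and n1: "18 * h ^ 2 * A \<le> n"
    and n2: "2 * chi * (18 * real h ^ 2 * real A / chi) ^ (3 * h) \<le> real n"
  shows "chi / real n * (1 - chi / real n) ^ (n - 1)
           \<le> measure_pmf.prob (mutate chi n x) {y. linf a x + 3 * h \<le> linf a y}"
proof -
  define Z where "Z = {i. i < n \<and> \<not> x ! i}"
  let ?p = "chi / real n"
  show ?thesis
  proof (cases "\<exists>i\<in>Z. 3 * h \<le> a i")
    case True
    then obtain i where "i < n" "\<not> x ! i" "3 * h \<le> a i" by (auto simp: Z_def)
    then show ?thesis by (intro prob_mutate_flip[OF x]) auto
  next
    case False
    define N where "N = card Z"
    define m where "m = 3 * h"
    have m: "m \<ge> 1" using h by (simp add: m_def)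
    have fZ: "finite Z" by (simp add: Z_def)
    have deficit: "linf a x + sum a Z = sum a {..<n}"
      unfolding Z_def by (rule linf_add_zeros[OF x])
    have "sum a Z \<le> (\<Sum>i\<in>Z. 3 * h)" using False by (intro sum_mono) (auto simp: not_le)
    then have "sum a Z \<le> N * (3 * h)" by (simp add: N_def)
    then have "sum a {..<n} - D \<le> N * (3 * h) + h" using deficit less by linarith
    then have "A * (sum a {..<n} - D) \<le> A * (N * (3 * h) + h)" by (rule mult_left_mono) simp
    then have "n \<le> A * (N * (3 * h) + h)" using far by linarith
    moreover have "2 * (A * h) \<le> n"
    proof -
      have "2 * (A * h) \<le> 18 * (A * (h * h))" using h by simp
      also have "\<dots> = 18 * h ^ 2 * A" by (simp add: power2_eq_square mult_ac)
      finally show ?thesis using n1 by linarith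
    qed
    ultimately have "n \<le> 6 * h * A * N" by (simp add: algebra_simps)
    then have N_real: "real n \<le> 6 * real h * real A * real N"
      by (metis of_nat_le_iff of_nat_mult of_nat_numeral)
    have pos: "6 * real h * real A > 0" "real m > 0" "real n > 0" using h A m rate_bounds by auto
    have N_ge: "real n / (6 * real h * real A) \<le> real N"
      using N_real pos by (simp add: field_simps)
    have "real m \<le> real n / (6 * real h * real A)"
    proof -
      have "real (18 * h ^ 2 * A) \<le> real n" using n1 of_nat_le_iff by blast
      then show ?thesis using pos by (simp add: field_simps m_def power2_eq_square)
    qed
    then have mN: "m \<le> N" using N_ge by linarith
    define \<theta> where "\<theta> = 18 * real h ^ 2 * real A"
    have \<theta>: "\<theta> > 0" using h A by (simp add: \<theta>_def)
    have "real n / \<theta> = real n / (6 * real h * real A) / real m"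
      using pos by (simp add: \<theta>_def m_def power2_eq_square field_simps)
    also have "\<dots> \<le> real N / real m" using N_ge pos by (intro divide_right_mono) auto
    finally have "(real n / \<theta>) ^ m \<le> (real N / real m) ^ m"
      using \<theta> by (intro power_mono) auto
    also have "\<dots> \<le> real (N choose m)" using mN by (rule binomial_ge_n_over_k_pow_k)
    finally have choose: "(real n / \<theta>) ^ m \<le> real (N choose m)" .
    have "(\<theta> / chi) ^ m * (2 * ?p) \<le> 1"
      using n2 pos rate by (simp add: \<theta>_def m_def field_simps)
    then have const: "2 * ?p \<le> (chi / \<theta>) ^ m"
      using \<theta> rate by (simp add: power_divide field_simps)
    have "?p * (1 - ?p) ^ (n - 1) * 1 \<le> ?p * (1 - ?p) ^ (n - 1) * (2 * (1 - ?p))"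
      using rate_bounds by (intro mult_left_mono mult_nonneg_nonneg zero_le_power) auto
    also have "\<dots> = 2 * ?p * (1 - ?p) ^ n"
      using rate_bounds(3) by (simp add: power_eq_if)
    also have "\<dots> \<le> (chi / \<theta>) ^ m * (1 - ?p) ^ (n - m)"
      using const rate_bounds \<theta> rate by (intro mult_mono power_decreasing) auto
    also have "(chi / \<theta>) ^ m = (real n / \<theta>) ^ m * ?p ^ m"
      using pos by (simp add: power_mult_distrib[symmetric])
    also have "(real n / \<theta>) ^ m * ?p ^ m * (1 - ?p) ^ (n - m) \<le> real (N choose m) * ?p ^ m * (1 - ?p) ^ (n - m)"
      using choose rate_bounds rate by (intro mult_right_mono) auto
    also have "\<dots> \<le> measure_pmf.prob (mutate chi n x) {y. linf a x + 3 * h \<le> linf a y}"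
    proof -
      have "linf a x + 3 * h \<le> linf a x + sum a S" if S: "S \<subseteq> Z" "card S = m" for S
      proof -
        have "sum (\<lambda>_. 1) S \<le> sum a S"
        proof (rule sum_mono)
          fix i assume "i \<in> S"
          then show "1 \<le> a i" using S pos_a by (force simp: Z_def Suc_le_eq)
        qed
        then show ?thesis using S by (simp add: m_def)
      qed
      then show ?thesis
        using prob_mutate_ge[OF x rate_bounds(1), of Z m "linf a x + 3 * h" a]
        by (simp add: Z_def N_def mult.assoc)
    qed
    finally show ?thesis by simp
  qed
qed

end

section \<open>Drift of the evolutionary algorithm\<close>

lemma growth_minus_ln_ge:
  fixes \<epsilon> :: real
  assumes "\<epsilon> > 0"
  shows "\<epsilon>\<^sup>2 / 2 \<le> (1 + \<epsilon> + \<epsilon>\<^sup>2) - 1 - ln (1 + \<epsilon> + \<epsilon>\<^sup>2)"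
proof -
  have "1 + \<epsilon> + \<epsilon>\<^sup>2 \<le> 1 + (\<epsilon> + \<epsilon>\<^sup>2 / 2) + (\<epsilon> + \<epsilon>\<^sup>2 / 2)\<^sup>2 / 2"
    using assms by (simp add: power2_eq_square field_simps)
  also have "\<dots> \<le> exp (\<epsilon> + \<epsilon>\<^sup>2 / 2)"
    using assms by (intro exp_lower_Taylor_quadratic) simp
  finally have "ln (1 + \<epsilon> + \<epsilon>\<^sup>2) \<le> ln (exp (\<epsilon> + \<epsilon>\<^sup>2 / 2))"
    using assms by (intro ln_mono) (auto intro: add_pos_nonneg)
  then show ?thesis by simp
qed

locale ea_linear =
  fixes chi c \<epsilon> :: real and n lam :: nat and a :: "nat \<Rightarrow> nat"
  assumes chi: "chi > 0" and \<epsilon>: "\<epsilon> > 0" and c: "c = exp chi * (1 + \<epsilon>) ^ 3"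
    and n_ge: "2 * chi \<le> real n" and lam: "lam > 0"
    and stay: "exp (- chi) * (1 + \<epsilon> + \<epsilon>\<^sup>2) / (1 + \<epsilon>)\<^sup>2 \<le> (1 - chi / real n) ^ n"
    and a_pos: "\<And>i. i < n \<Longrightarrow> a i > 0" and a_anti: "\<And>i j. i \<le> j \<Longrightarrow> j < n \<Longrightarrow> a j \<le> a i"
begin

definition pops :: "population set" where
  "pops = {P. length P = lam \<and> (\<forall>x\<in>set P. length x = n)}"

definition offspring :: "population \<Rightarrow> bits pmf" where
  "offspring P = fp_select (\<lambda>x. c ^ linf a x) P \<bind> (\<lambda>i. mutate chi n (P ! i))"

definition step :: "population \<Rightarrow> population pmf" where
  "step = ea_step (fp_select (\<lambda>x. c ^ linf a x)) (mutate chi n)"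

definition above :: "nat \<Rightarrow> population \<Rightarrow> nat" where
  "above F P = count_if (\<lambda>x. F \<le> linf a x) P"

definition hit :: "nat \<Rightarrow> population \<Rightarrow> real" where
  "hit F P = measure_pmf.prob (offspring P) {y. F \<le> linf a y}"

definition thr :: real where "thr = \<epsilon> / c * real lam"

definition fail :: real where "fail = exp (- (\<epsilon> ^ 3 / (2 * c) * real lam))"

definition flip :: real where "flip = chi / real n * (1 - chi / real n) ^ (n - 1)"

abbreviation growth :: real where "growth \<equiv> 1 + \<epsilon> + \<epsilon>\<^sup>2"

lemma c_gt_1: "c > 1"
proof -
  have "exp chi > 1" "(1 + \<epsilon>) ^ 3 > 1" using chi \<epsilon> by (auto intro: one_less_power)
  then show ?thesis unfolding c by (simp add: less_1_mult)
qed

lemma \<epsilon>_le_c: "\<epsilon> \<le> c"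
proof -
  have "1 + \<epsilon> \<le> (1 + \<epsilon>) ^ 3" using \<epsilon> by (intro self_le_power) auto
  also have "\<dots> \<le> exp chi * (1 + \<epsilon>) ^ 3" using chi \<epsilon> by simp
  finally show ?thesis by (simp add: c)
qed

lemma flip_pos: "flip > 0"
  using rate_bounds[OF chi n_ge] chi by (auto simp: flip_def)

lemma pops_nonempty: "P \<in> pops \<Longrightarrow> P \<noteq> []"
  using lam by (auto simp: pops_def)

lemma step_eq: "P \<in> pops \<Longrightarrow> step P = iid_list lam (offspring P)"
  by (simp add: step_def ea_step_def offspring_def pops_def)

lemma set_pmf_offspring: "P \<in> pops \<Longrightarrow> set_pmf (offspring P) \<subseteq> {y. length y = n}"
  using set_pmf_fp_select[of P "\<lambda>x. c ^ linf a x"] pops_nonempty[of P] c_gt_1 set_pmf_mutate_subset[of chi n]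
  by (fastforce simp: offspring_def pops_def)

lemma finite_step: "P \<in> pops \<Longrightarrow> finite (set_pmf (step P))"
  unfolding step_eq
  by (intro finite_set_pmf_iid_list finite_subset[OF set_pmf_offspring finite_length_eq_bits])

lemma set_pmf_step: "P \<in> pops \<Longrightarrow> set_pmf (step P) \<subseteq> pops"
  unfolding step_eq
  using set_pmf_iid_list_subset[of lam "offspring P"] set_pmf_offspring[of P]
  by (fastforce simp: pops_def)

lemma integrable_step: "P \<in> pops \<Longrightarrow> integrable (step P) (f :: population \<Rightarrow> real)"
  by (intro integrable_measure_pmf_finite finite_step)

lemma hit_bounds: "hit F P \<in> {0..1}"
  by (simp add: hit_def)

lemma map_pmf_above_step: "P \<in> pops \<Longrightarrow> map_pmf (above F) (step P) = binomial_pmf lam (hit F P)"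
  unfolding step_eq above_def hit_def by (rule count_if_iid_list)

lemma expectation_above_step:
  fixes \<phi> :: "nat \<Rightarrow> real"
  assumes "P \<in> pops"
  shows "measure_pmf.expectation (step P) (\<lambda>P'. \<phi> (above F P')) = measure_pmf.expectation (binomial_pmf lam (hit F P)) \<phi>"
  unfolding map_pmf_above_step[OF assms, symmetric] by simp

lemma hit_ge:
  assumes P: "P \<in> pops"
    and r: "\<And>x. length x = n \<Longrightarrow> Q x \<Longrightarrow> r \<le> measure_pmf.prob (mutate chi n x) {y. F \<le> linf a y}"
  shows "r * sel_prob (\<lambda>x. c ^ linf a x) P Q \<le> hit F P"
  unfolding hit_def offspring_def
  using P c_gt_1 by (intro prob_offspring_ge finite_set_pmf_mutate r) (auto simp: pops_nonempty pops_def)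

lemma hit_ge_stay:
  assumes P: "P \<in> pops"
  shows "exp (- chi) * growth / (1 + \<epsilon>)\<^sup>2 * sel_prob (\<lambda>x. c ^ linf a x) P (\<lambda>x. F \<le> linf a x) \<le> hit F P"
  using prob_mutate_stay[OF chi n_ge, of _ F a] stay by (intro hit_ge P) (metis order_trans)

lemma sel_prob_above:
  assumes "P \<in> pops" "thr \<le> real (above M P)"
  shows "\<epsilon> / (1 + \<epsilon>) \<le> sel_prob (\<lambda>x. c ^ linf a x) P (\<lambda>x. M \<le> linf a x)"
  using assms pops_nonempty by (intro sel_prob_power_ge c_gt_1 \<epsilon>) (auto simp: thr_def above_def pops_def)

lemma hit_ge_flip:
  assumes P: "P \<in> pops" and M: "thr \<le> real (above M P)"
    and r: "\<And>x. length x = n \<Longrightarrow> M \<le> linf a x \<Longrightarrow> flip \<le> measure_pmf.prob (mutate chi n x) {y. F \<le> linf a y}"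
  shows "\<epsilon> / (1 + \<epsilon>) * flip \<le> hit F P"
proof -
  have "flip * (\<epsilon> / (1 + \<epsilon>)) \<le> flip * sel_prob (\<lambda>x. c ^ linf a x) P (\<lambda>x. M \<le> linf a x)"
    using sel_prob_above[OF P M] flip_pos by (intro mult_left_mono) auto
  also have "\<dots> \<le> hit F P" by (intro hit_ge P r)
  finally show ?thesis by (simp add: mult.commute)
qed

lemma prob_above_less_thr:
  assumes P: "P \<in> pops"
    and sel: "\<epsilon> / (1 + \<epsilon>) \<le> sel_prob (\<lambda>x. c ^ linf a x) P (\<lambda>x. M \<le> linf a x)"
  shows "measure_pmf.prob (step P) {P'. real (above M P') < thr} \<le> fail"
proof -
  have "growth * (\<epsilon> / c) = exp (- chi) * growth / (1 + \<epsilon>)\<^sup>2 * (\<epsilon> / (1 + \<epsilon>))"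
    using \<epsilon> by (simp add: c exp_minus field_simps power2_eq_square power3_eq_cube)
  also have "\<dots> \<le> exp (- chi) * growth / (1 + \<epsilon>)\<^sup>2 * sel_prob (\<lambda>x. c ^ linf a x) P (\<lambda>x. M \<le> linf a x)"
    using sel \<epsilon> by (intro mult_left_mono) (auto intro!: divide_nonneg_pos mult_nonneg_nonneg)
  also have "\<dots> \<le> hit M P" by (rule hit_ge_stay[OF P])
  finally have hit: "growth * (\<epsilon> / c) \<le> hit M P" .
  have "measure_pmf.prob (step P) {P'. real (above M P') < thr}
      = measure_pmf.prob (map_pmf (above M) (step P)) {k. real k < thr}"
    by (simp add: vimage_def)
  also have "\<dots> \<le> exp (- (\<epsilon> / c * real lam * (growth - 1 - ln growth)))"
    unfolding map_pmf_above_step[OF P] thr_def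
    using \<epsilon> hit by (intro prob_binomial_pmf_less_le hit_bounds) auto
  also have "\<dots> \<le> exp (- (\<epsilon> / c * real lam * (\<epsilon>\<^sup>2 / 2)))"
    using growth_minus_ln_ge[OF \<epsilon>] c_gt_1 \<epsilon>
    by (simp only: exp_le_cancel_iff neg_le_iff_le) (intro mult_left_mono; simp)
  also have "\<dots> = fail"
    by (simp add: fail_def power2_eq_square power3_eq_cube mult_ac)
  finally show ?thesis .
qed

text \<open>\<open>M + h\<close> is where progress towards reaching \<open>M\<close> is measured.\<close>

definition level_pot :: "nat \<Rightarrow> nat \<Rightarrow> real \<Rightarrow> real \<Rightarrow> real \<Rightarrow> population \<Rightarrow> real" where
  "level_pot M h b W \<kappa> P =
     (if thr \<le> real (above M P) then 0 else level_cost b W \<kappa> lam (above (M + h) P))"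

lemma above_le: "P \<in> pops \<Longrightarrow> above F P \<le> lam"
  unfolding above_def pops_def using count_if_le by auto

lemma level_pot_bounds:
  assumes "b \<ge> 0" "W \<ge> 0" "\<kappa> \<ge> 0" "P \<in> pops"
  shows "0 \<le> level_pot M h b W \<kappa> P" "level_pot M h b W \<kappa> P \<le> level_cost b W \<kappa> lam 0"
  using level_cost_ge_1[OF above_le[OF assms(4)], of b W \<kappa> "M + h"] level_cost_ge_1[of 0 lam b W \<kappa>]
    level_cost_antimono[of b W \<kappa> 0 "above (M + h) P" lam] assms
  by (auto simp: level_pot_def)

lemma level_pot_drift:
  assumes P: "P \<in> pops" and adm: "admissible_cost R y b W \<kappa>" and R: "R \<le> c ^ h * growth"
  shows level_pot_nonincreasing: "measure_pmf.expectation (step P) (level_pot M h b W \<kappa>)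
      \<le> level_pot M h b W \<kappa> P + fail * level_cost b W \<kappa> lam 0"
    and level_pot_decreasing: "real (above M P) < thr \<Longrightarrow> y \<le> real lam * hit (M + h) P \<Longrightarrow>
      measure_pmf.expectation (step P) (level_pot M h b W \<kappa>)
      \<le> level_pot M h b W \<kappa> P - 1 + fail * level_cost b W \<kappa> lam 0"
proof -
  let ?G = "level_pot M h b W \<kappa>" and ?C = "level_cost b W \<kappa> lam"
  let ?sel = "\<lambda>F. sel_prob (\<lambda>x. c ^ linf a x) P (\<lambda>x. F \<le> linf a x)"
  have nonneg: "b \<ge> 0" "W \<ge> 0" "\<kappa> \<ge> 0" using adm by (auto simp: admissible_cost_def)
  have C1: "1 \<le> ?C 0" using nonneg by (intro level_cost_ge_1) auto
  have fail: "fail * ?C 0 \<ge> 0" using C1 by (simp add: fail_def)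
  have C_ge_1: "1 \<le> ?C (above (M + h) P)" using nonneg above_le[OF P] by (intro level_cost_ge_1) auto
  have pops': "AE P' in step P. P' \<in> pops"
    using set_pmf_step[OF P] by (auto simp: AE_measure_pmf_iff)
  have good: "measure_pmf.expectation (step P) ?G \<le> fail * ?C 0" if "\<epsilon> / (1 + \<epsilon>) \<le> ?sel M"
  proof -
    have "measure_pmf.expectation (step P) ?G
        \<le> measure_pmf.expectation (step P) (\<lambda>P'. ?C 0 * indicator {P'. real (above M P') < thr} P')"
    proof (rule integral_mono_AE[OF integrable_step[OF P] integrable_step[OF P]])
      show "AE P' in step P. ?G P' \<le> ?C 0 * indicator {P'. real (above M P') < thr} P'"
        using pops'
      proof eventually_elim
        case (elim P')
        then show ?case
          using level_pot_bounds(2)[OF nonneg elim, of M h] by (auto simp: level_pot_def indicator_def)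
      qed
    qed
    also have "\<dots> = ?C 0 * measure_pmf.prob (step P) {P'. real (above M P') < thr}" by simp
    also have "\<dots> \<le> ?C 0 * fail"
      using prob_above_less_thr[OF P that] C1 by (intro mult_left_mono) auto
    finally show ?thesis by (simp add: mult.commute)
  qed
  have bad: "real (above M P) < thr \<and> R * real (above (M + h) P) \<le> real lam * hit (M + h) P \<and>
      measure_pmf.expectation (step P) ?G \<le> measure_pmf.expectation (binomial_pmf lam (hit (M + h) P)) ?C"
    if n: "\<not> \<epsilon> / (1 + \<epsilon>) \<le> ?sel M"
  proof (intro conjI)
    let ?k = "real (above (M + h) P)"
    show "real (above M P) < thr" using n sel_prob_above[OF P, of M] by linarith
    have lenP: "length P = lam" using P by (simp add: pops_def)
    have sel: "?k / real lam * c ^ Suc h / (1 + \<epsilon>) \<le> ?sel (M + h)"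
      using sel_prob_power_cases[OF c_gt_1 \<epsilon> pops_nonempty[OF P], where M = M and f = "linf a" and h = h] n
      by (simp add: above_def lenP)
    have "R * ?k \<le> c ^ h * growth * ?k" using R by (intro mult_right_mono) auto
    also have "\<dots> = real lam * (exp (- chi) * growth / (1 + \<epsilon>)\<^sup>2 * (?k / real lam * c ^ Suc h / (1 + \<epsilon>)))"
    proof -
      have cancel: "inverse u * g / t\<^sup>2 * (u * t ^ 3) / t = g" if "u > 0" "t > 0" for u g t :: real
        using that by (simp add: field_simps power2_eq_square power3_eq_cube)
      have "exp (- chi) * growth / (1 + \<epsilon>)\<^sup>2 * c / (1 + \<epsilon>) = growth"
        unfolding c exp_minus using \<epsilon> by (intro cancel) auto
      moreover have "real lam * (exp (- chi) * growth / (1 + \<epsilon>)\<^sup>2 * (?k / real lam * c ^ Suc h / (1 + \<epsilon>)))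
          = c ^ h * (exp (- chi) * growth / (1 + \<epsilon>)\<^sup>2 * c / (1 + \<epsilon>)) * ?k"
        using lam by simp
      ultimately show ?thesis by simp
    qed
    also have "\<dots> \<le> real lam * (exp (- chi) * growth / (1 + \<epsilon>)\<^sup>2 * ?sel (M + h))"
      using sel \<epsilon> by (intro mult_left_mono) (auto intro!: divide_nonneg_pos mult_nonneg_nonneg)
    also have "\<dots> \<le> real lam * hit (M + h) P"
      by (intro mult_left_mono hit_ge_stay P) simp
    finally show "R * ?k \<le> real lam * hit (M + h) P" .
    have "measure_pmf.expectation (step P) ?G \<le> measure_pmf.expectation (step P) (\<lambda>P'. ?C (above (M + h) P'))"
    proof (rule integral_mono_AE[OF integrable_step[OF P] integrable_step[OF P]])
      show "AE P' in step P. ?G P' \<le> ?C (above (M + h) P')"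
        using pops'
      proof eventually_elim
        case (elim P')
        then show ?case
          using level_cost_ge_1[OF above_le[OF elim] nonneg(1,2), of \<kappa> "M + h"] by (auto simp: level_pot_def)
      qed
    qed
    then show "measure_pmf.expectation (step P) ?G \<le> measure_pmf.expectation (binomial_pmf lam (hit (M + h) P)) ?C"
      by (simp add: expectation_above_step[OF P])
  qed
  show "measure_pmf.expectation (step P) ?G \<le> ?G P + fail * ?C 0"
  proof (cases "\<epsilon> / (1 + \<epsilon>) \<le> ?sel M")
    case True
    then show ?thesis using good level_pot_bounds(1)[OF nonneg P, of M h] by fastforce
  next
    case False
    have "?G P = ?C (above (M + h) P)" using bad[OF False] by (simp add: level_pot_def)
    then show ?thesis
      using bad[OF False] expectation_level_cost_nonincreasing[OF hit_bounds adm, of "above (M + h) P" lam "M + h" P] fail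
      by linarith
  qed
  show "measure_pmf.expectation (step P) ?G \<le> ?G P - 1 + fail * ?C 0"
    if less: "real (above M P) < thr" and y: "y \<le> real lam * hit (M + h) P"
  proof -
    have G: "?G P = ?C (above (M + h) P)" using less by (simp add: level_pot_def)
    show ?thesis
    proof (cases "\<epsilon> / (1 + \<epsilon>) \<le> ?sel M")
      case True
      then show ?thesis using good C_ge_1 G by fastforce
    next
      case False
      then show ?thesis
        using bad[OF False] expectation_level_cost_decreasing[OF hit_bounds adm _ y, of "above (M + h) P"] fail G
        by linarith
    qed
  qed
qed

definition rate_hit :: real where "rate_hit = real lam * (\<epsilon> / (1 + \<epsilon>) * flip)"

abbreviation prefix :: "nat \<Rightarrow> nat" where "prefix k \<equiv> sum a {..<k}"

context
  fixes h A :: nat and bf Wf bs Ws \<kappa> :: real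
  assumes h: "h \<ge> 1" and A: "A \<ge> 1" and n1: "18 * h ^ 2 * A \<le> n"
    and n2: "2 * chi * (18 * real h ^ 2 * real A / chi) ^ (3 * h) \<le> real n"
    and fast: "admissible_cost (c ^ h) rate_hit bf Wf 1"
    and slow: "admissible_cost growth rate_hit bs Ws \<kappa>"
begin

definition mid_pot :: "nat \<Rightarrow> population \<Rightarrow> real" where
  "mid_pot i = level_pot (prefix (Suc i) - h) h bf Wf 1"

definition end_pot :: "nat \<Rightarrow> population \<Rightarrow> real" where
  "end_pot i = (if n \<le> A * (prefix n - prefix (Suc i)) then level_pot (prefix (Suc i)) h bf Wf 1
                else level_pot (prefix (Suc i)) 0 bs Ws \<kappa>)"

definition mid_max :: real where "mid_max = level_cost bf Wf 1 lam 0"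

definition end_max :: "nat \<Rightarrow> real" where
  "end_max i = (if n \<le> A * (prefix n - prefix (Suc i)) then level_cost bf Wf 1 lam 0
                else level_cost bs Ws \<kappa> lam 0)"

definition pot :: "population \<Rightarrow> real" where
  "pot P = (\<Sum>i<n. mid_pot i P + end_pot i P)"

definition pot_max :: real where
  "pot_max = (\<Sum>i<n. mid_max + end_max i)"

lemma flip_le_prob_stay:
  assumes "length x = n" "F \<le> linf a x"
  shows "flip \<le> measure_pmf.prob (mutate chi n x) {y. F \<le> linf a y}"
  unfolding flip_def using flip_le_stay[OF chi n_ge] prob_mutate_stay[OF chi n_ge assms] by linarith

lemma flip_le_prob_prefix:
  assumes "length x = n" "i < n" "linf a x < prefix (Suc i)" "F \<le> linf a x + a i"
  shows "flip \<le> measure_pmf.prob (mutate chi n x) {y. F \<le> linf a y}"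
proof -
  obtain l where l: "l \<le> i" "\<not> x ! l" using zero_in_prefix[OF assms(1-3)] .
  then have "a i \<le> a l" using a_anti assms(2) by simp
  then show ?thesis
    unfolding flip_def using l assms by (intro prob_mutate_flip[OF chi n_ge, of _ l]) auto
qed

lemma flip_le_prob_far:
  assumes x: "length x = n" and far: "n \<le> A * (prefix n - D)" and "linf a x < D + h"
    and F: "F \<le> linf a x + 3 * h"
  shows "flip \<le> measure_pmf.prob (mutate chi n x) {y. F \<le> linf a y}"
proof -
  have "flip \<le> measure_pmf.prob (mutate chi n x) {y. linf a x + 3 * h \<le> linf a y}"
    unfolding flip_def using assms by (intro prob_mutate_big_gain[OF chi n_ge x a_pos h A _ _ n1 n2]) auto
  also have "\<dots> \<le> measure_pmf.prob (mutate chi n x) {y. F \<le> linf a y}"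
    using F by (intro measure_pmf.finite_measure_mono) auto
  finally show ?thesis .
qed

lemma mid_pot_nonincreasing:
  "P \<in> pops \<Longrightarrow> measure_pmf.expectation (step P) (mid_pot i) \<le> mid_pot i P + fail * mid_max"
  unfolding mid_pot_def mid_max_def using \<epsilon> c_gt_1 by (intro level_pot_nonincreasing[OF _ fast]) auto

lemma end_pot_nonincreasing:
  "P \<in> pops \<Longrightarrow> measure_pmf.expectation (step P) (end_pot i) \<le> end_pot i P + fail * end_max i"
  unfolding end_pot_def end_max_def
  using level_pot_nonincreasing[OF _ fast] level_pot_nonincreasing[OF _ slow, of _ 0] \<epsilon> c_gt_1 by auto

lemma current_level_decreasing:
  assumes P: "P \<in> pops" and i: "i < n" and reached: "thr \<le> real (above (prefix i) P)"
    and open_level: "real (above (prefix (Suc i)) P) < thr"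
  shows "measure_pmf.expectation (step P) (mid_pot i) + measure_pmf.expectation (step P) (end_pot i)
    \<le> mid_pot i P + end_pot i P - 1 + fail * (mid_max + end_max i)"
proof -
  have fast_growth: "c ^ h \<le> c ^ h * growth" using c_gt_1 \<epsilon> by simp
  have Suc_prefix: "prefix (Suc i) = prefix i + a i" by simp
  show ?thesis
  proof (cases "2 * h \<le> a i \<and> real (above (prefix (Suc i) - h) P) < thr")
    case True
    have T: "prefix (Suc i) - h + h = prefix (Suc i)" using True Suc_prefix by linarith
    have "\<epsilon> / (1 + \<epsilon>) * flip \<le> hit (prefix (Suc i) - h + h) P"
    proof (rule hit_ge_flip[OF P reached])
      fix x :: bits assume x: "length x = n" "prefix i \<le> linf a x"
      show "flip \<le> measure_pmf.prob (mutate chi n x) {y. prefix (Suc i) - h + h \<le> linf a y}"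
      proof (cases "linf a x < prefix (Suc i)")
        case True
        then show ?thesis unfolding T using x i by (intro flip_le_prob_prefix) auto
      next
        case False
        then show ?thesis unfolding T using x by (intro flip_le_prob_stay) auto
      qed
    qed
    then have "rate_hit \<le> real lam * hit (prefix (Suc i) - h + h) P"
      unfolding rate_hit_def by (intro mult_left_mono) auto
    then have "measure_pmf.expectation (step P) (mid_pot i) \<le> mid_pot i P - 1 + fail * mid_max"
      unfolding mid_pot_def mid_max_def using True fast_growth
      by (intro level_pot_decreasing[OF P fast]) auto
    then show ?thesis using end_pot_nonincreasing[OF P, of i] by (simp add: distrib_left)
  next
    case False
    have "measure_pmf.expectation (step P) (end_pot i) \<le> end_pot i P - 1 + fail * end_max i"
    proof (cases "n \<le> A * (prefix n - prefix (Suc i))")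
      case far: True
      have "\<epsilon> / (1 + \<epsilon>) * flip \<le> hit (prefix (Suc i) + h) P"
      proof (cases "2 * h \<le> a i")
        case True
        with False have mid: "thr \<le> real (above (prefix (Suc i) - h) P)" by simp
        show ?thesis
        proof (rule hit_ge_flip[OF P mid])
          fix x :: bits assume x: "length x = n" "prefix (Suc i) - h \<le> linf a x"
          consider "linf a x < prefix (Suc i)"
            | "prefix (Suc i) \<le> linf a x" "linf a x < prefix (Suc i) + h"
            | "prefix (Suc i) + h \<le> linf a x" by linarith
          then show "flip \<le> measure_pmf.prob (mutate chi n x) {y. prefix (Suc i) + h \<le> linf a y}"
          proof cases
            case 1
            then show ?thesis using x i True Suc_prefix by (intro flip_le_prob_prefix[of x i]) linarith+
          next
            case 2
            then show ?thesis using x by (intro flip_le_prob_far[OF x(1) far]) linarith+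
          next
            case 3
            then show ?thesis using x by (intro flip_le_prob_stay) auto
          qed
        qed
      next
        case small: False
        show ?thesis
        proof (rule hit_ge_flip[OF P reached])
          fix x :: bits assume x: "length x = n" "prefix i \<le> linf a x"
          show "flip \<le> measure_pmf.prob (mutate chi n x) {y. prefix (Suc i) + h \<le> linf a y}"
          proof (cases "linf a x < prefix (Suc i) + h")
            case True
            then show ?thesis using x small Suc_prefix by (intro flip_le_prob_far[OF x(1) far]) linarith+
          next
            case False
            then show ?thesis using x by (intro flip_le_prob_stay) auto
          qed
        qed
      qed
      then have "rate_hit \<le> real lam * hit (prefix (Suc i) + h) P"
        unfolding rate_hit_def by (intro mult_left_mono) auto
      then have "measure_pmf.expectation (step P) (level_pot (prefix (Suc i)) h bf Wf 1)
          \<le> level_pot (prefix (Suc i)) h bf Wf 1 P - 1 + fail * level_cost bf Wf 1 lam 0"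
        using open_level fast_growth by (intro level_pot_decreasing[OF P fast])
      then show ?thesis using far by (simp add: end_pot_def end_max_def)
    next
      case near: False
      have "\<epsilon> / (1 + \<epsilon>) * flip \<le> hit (prefix (Suc i)) P"
      proof (rule hit_ge_flip[OF P reached])
        fix x :: bits assume x: "length x = n" "prefix i \<le> linf a x"
        show "flip \<le> measure_pmf.prob (mutate chi n x) {y. prefix (Suc i) \<le> linf a y}"
        proof (cases "linf a x < prefix (Suc i)")
          case True
          then show ?thesis using x i by (intro flip_le_prob_prefix) auto
        next
          case False
          then show ?thesis using x by (intro flip_le_prob_stay) auto
        qed
      qed
      then have "rate_hit \<le> real lam * hit (prefix (Suc i) + 0) P"
        unfolding rate_hit_def add_0_right by (rule mult_left_mono) simp
      then have "measure_pmf.expectation (step P) (level_pot (prefix (Suc i)) 0 bs Ws \<kappa>)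
          \<le> level_pot (prefix (Suc i)) 0 bs Ws \<kappa> P - 1 + fail * level_cost bs Ws \<kappa> lam 0"
        using open_level by (intro level_pot_decreasing[OF P slow]) auto
      then show ?thesis using near by (simp add: end_pot_def end_max_def)
    qed
    then show ?thesis using mid_pot_nonincreasing[OF P, of i] by (simp add: distrib_left)
  qed
qed

lemma thr_bounds: "0 < thr" "thr \<le> real lam"
  using \<epsilon> \<epsilon>_le_c c_gt_1 lam by (auto simp: thr_def field_simps)

lemma linf_le_prefix: "length x = n \<Longrightarrow> linf a x \<le> prefix n"
  using linf_add_zeros[of x n a] by linarith

lemma exists_current_level:
  assumes P: "P \<in> pops" and nf: "\<forall>x\<in>set P. \<not> is_optimum n (linf a) x"
  obtains i where "i < n" "thr \<le> real (above (prefix i) P)" "real (above (prefix (Suc i)) P) < thr"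
proof -
  have "filter (\<lambda>x. prefix n \<le> linf a x) P = []"
  proof (rule ccontr)
    assume "filter (\<lambda>x. prefix n \<le> linf a x) P \<noteq> []"
    then obtain x where "x \<in> set P" "prefix n \<le> linf a x" by (auto simp: filter_empty_conv)
    then have "is_optimum n (linf a) x"
      using P linf_le_prefix by (auto simp: is_optimum_def pops_def intro: order_trans)
    then show False using nf \<open>x \<in> set P\<close> by blast
  qed
  then have last: "real (above (prefix n) P) < thr"
    using thr_bounds by (simp add: above_def count_if_def)
  define k where "k = (LEAST k. real (above (prefix k) P) < thr)"
  have k: "real (above (prefix k) P) < thr" unfolding k_def using last by (rule LeastI)
  have kn: "k \<le> n" unfolding k_def using last by (rule Least_le)
  have "k \<noteq> 0"
  proof
    assume "k = 0"
    then have "real (length P) < thr" using k by (simp add: above_def count_if_def)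
    then show False using thr_bounds P by (simp add: pops_def)
  qed
  then obtain i where i: "k = Suc i" by (cases k) auto
  have "\<not> real (above (prefix i) P) < thr"
    using not_less_Least[of i "\<lambda>k. real (above (prefix k) P) < thr"] i by (simp add: k_def)
  then show ?thesis using that[of i] k kn i by auto
qed

lemma pot_drift:
  assumes P: "P \<in> pops" and nf: "\<forall>x\<in>set P. \<not> is_optimum n (linf a) x"
  shows "measure_pmf.expectation (step P) pot \<le> pot P - 1 + fail * pot_max"
proof -
  let ?E = "measure_pmf.expectation (step P)"
  obtain i where i: "i < n" "thr \<le> real (above (prefix i) P)" "real (above (prefix (Suc i)) P) < thr"
    using exists_current_level[OF P nf] .
  have "?E pot = (\<Sum>j<n. ?E (mid_pot j) + ?E (end_pot j))"
    unfolding pot_def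
    by (subst Bochner_Integration.integral_sum)
       (auto intro!: sum.cong Bochner_Integration.integral_add integrable_step P)
  also have "\<dots> \<le> (\<Sum>j<n. mid_pot j P + end_pot j P + fail * (mid_max + end_max j) - (if j = i then 1 else 0))"
  proof (rule sum_mono)
    fix j
    show "?E (mid_pot j) + ?E (end_pot j)
        \<le> mid_pot j P + end_pot j P + fail * (mid_max + end_max j) - (if j = i then 1 else 0)"
      using mid_pot_nonincreasing[OF P, of j] end_pot_nonincreasing[OF P, of j]
        current_level_decreasing[OF P i] by (auto simp: distrib_left)
  qed
  also have "\<dots> = pot P - 1 + fail * pot_max"
    using i(1) by (simp add: pot_def pot_max_def sum.distrib sum_subtractf sum_distrib_left[symmetric])
  finally show ?thesis .
qed

lemma cost_params_nonneg: "bf \<ge> 0" "Wf \<ge> 0" "bs \<ge> 0" "Ws \<ge> 0" "\<kappa> \<ge> 0"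
  using fast slow by (auto simp: admissible_cost_def)

lemma pot_bounds:
  assumes "P \<in> pops"
  shows "0 \<le> pot P" "pot P \<le> pot_max"
proof -
  have mid: "0 \<le> mid_pot i P" "mid_pot i P \<le> mid_max" for i
    unfolding mid_pot_def mid_max_def using cost_params_nonneg assms by (intro level_pot_bounds; simp)+
  have "0 \<le> end_pot i P \<and> end_pot i P \<le> end_max i" for i
    unfolding end_pot_def end_max_def using cost_params_nonneg assms by (simp add: level_pot_bounds)
  with mid show "0 \<le> pot P" "pot P \<le> pot_max"
    unfolding pot_def pot_max_def by (auto intro!: sum_nonneg sum_mono add_mono)
qed

lemma set_pmf_init: "set_pmf (init_pop n lam) \<subseteq> pops"
proof -
  have "set_pmf (pmf_of_set {x :: bits. length x = n}) = {x. length x = n}"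
    using finite_length_eq_bits Ex_list_of_length by (intro set_pmf_of_set) auto
  then show ?thesis
    unfolding init_pop_def pops_def
    using set_pmf_iid_list_subset[of lam "pmf_of_set {x :: bits. length x = n}"] by auto
qed

lemma expected_runtime_le_pot_max:
  assumes small: "fail * pot_max \<le> 1 / 2"
  shows "expected_runtime n lam (linf a) step \<le> ennreal (real lam * (2 * pot_max))"
proof (rule expected_runtime_le[OF lam])
  fix m
  \<comment> \<open>\<open>pot\<close> may be negative outside \<open>pops\<close>\<close>
  have "measure_pmf.expectation (step P) (\<lambda>P. \<bar>pot P\<bar>) \<le> \<bar>pot P\<bar> - 1 / 2"
    if P: "P \<in> pops" and nf: "\<forall>x\<in>set P. \<not> is_optimum n (linf a) x" for P
  proof -
    have "measure_pmf.expectation (step P) (\<lambda>P. \<bar>pot P\<bar>) = measure_pmf.expectation (step P) pot"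
      using set_pmf_step[OF P] pot_bounds(1) by (intro integral_cong_AE) (auto simp: AE_measure_pmf_iff)
    then show ?thesis using pot_drift[OF P nf] small by linarith
  qed
  then have "(\<Sum>t<m. not_found_prob n (linf a) (init_pop n lam) step t) \<le> pot_max / (1 / 2)"
    using set_pmf_init set_pmf_step finite_step pot_bounds
    by (intro sum_not_found_prob_le[where I = pops and V = "\<lambda>P. \<bar>pot P\<bar>"]) auto
  then show "(\<Sum>t<m. not_found_prob n (linf a) (init_pop n lam) step t) \<le> 2 * pot_max" by simp
qed

lemma pot_max_le:
  assumes "A \<le> n"
  shows "pot_max \<le> 2 * real n * level_cost bf Wf 1 lam 0 + 2 * real n / real A * level_cost bs Ws \<kappa> lam 0"
proof -
  let ?Cf = "level_cost bf Wf 1 lam 0" and ?Cs = "level_cost bs Ws \<kappa> lam 0"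
  define J where "J = {i. i < n \<and> \<not> n \<le> A * (prefix n - prefix (Suc i))}"
  have pos: "0 \<le> ?Cf" "0 \<le> ?Cs"
    using level_cost_ge_1[of 0 lam] cost_params_nonneg by (smt (verit) le0)+
  have "end_max i \<le> ?Cf + (if i \<in> J then ?Cs else 0)" if "i < n" for i
    using that pos by (auto simp: end_max_def J_def)
  then have "pot_max \<le> (\<Sum>i<n. 2 * ?Cf + (if i \<in> J then ?Cs else 0))"
    unfolding pot_max_def mid_max_def by (intro sum_mono) fastforce
  also have "\<dots> = 2 * real n * ?Cf + real (card ({..<n} \<inter> J)) * ?Cs"
    by (simp add: sum.distrib sum.If_cases)
  also have "\<dots> \<le> 2 * real n * ?Cf + 2 * real n / real A * ?Cs"
  proof (intro add_left_mono mult_right_mono pos)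
    have "{..<n} \<inter> J \<subseteq> {n - Suc (n div A)..<n}"
    proof
      fix i assume "i \<in> {..<n} \<inter> J"
      then have i: "i < n" "A * (prefix n - prefix (Suc i)) < n" by (auto simp: J_def)
      have "n - Suc i = (\<Sum>j\<in>{Suc i..<n}. 1)" by simp
      also have "\<dots> \<le> sum a {Suc i..<n}"
        using a_pos by (intro sum_mono) (auto simp: Suc_le_eq)
      also have "\<dots> = prefix n - prefix (Suc i)"
      proof -
        have "prefix n = prefix (Suc i) + sum a {Suc i..<n}"
          using i(1) by (simp only: atLeast0LessThan[symmetric]) (rule sum.atLeastLessThan_concat[symmetric]; simp)
        then show ?thesis by linarith
      qed
      finally have "A * (n - Suc i) < n" using i(2) by (meson le_less_trans mult_le_mono2)
      then have "n - Suc i \<le> n div A"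
        using A by (simp add: less_eq_div_iff_mult_less_eq mult.commute)
      then show "i \<in> {n - Suc (n div A)..<n}" using i(1) by auto
    qed
    then have "card ({..<n} \<inter> J) \<le> Suc (n div A)"
      using card_mono[of "{n - Suc (n div A)..<n}" "{..<n} \<inter> J"] by simp
    then have "real (card ({..<n} \<inter> J)) \<le> real (n div A) + 1" by linarith
    also have "\<dots> \<le> real n / real A + 1"
    proof -
      have "real (n div A * A) \<le> real n" unfolding of_nat_le_iff by simp
      then show ?thesis using A by (simp add: field_simps)
    qed
    also have "\<dots> \<le> 2 * real n / real A" using assms A by (simp add: field_simps)
    finally show "real (card ({..<n} \<inter> J)) \<le> 2 * real n / real A" .
  qed
  finally show ?thesis .
qed

end

lemma rate_hit_ge: "real lam * \<epsilon> * chi * growth / (real n * c) \<le> rate_hit"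
proof -
  have "exp (- chi) * growth / (1 + \<epsilon>)\<^sup>2 \<le> (1 - chi / real n) ^ n" by (rule stay)
  also have "\<dots> \<le> (1 - chi / real n) ^ (n - 1)"
    using rate_bounds[OF chi n_ge] by (intro power_decreasing) auto
  finally have "real lam * (\<epsilon> / (1 + \<epsilon>) * (chi / real n * (exp (- chi) * growth / (1 + \<epsilon>)\<^sup>2))) \<le> rate_hit"
    unfolding rate_hit_def flip_def using \<epsilon> chi by (intro mult_left_mono) auto
  moreover have "real lam * (\<epsilon> / (1 + \<epsilon>) * (chi / real n * (exp (- chi) * growth / (1 + \<epsilon>)\<^sup>2)))
      = real lam * \<epsilon> * chi * growth / (real n * c)"
    using \<epsilon> rate_bounds(3)[OF chi n_ge]
    by (simp add: c exp_minus field_simps power2_eq_square power3_eq_cube)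
  ultimately show ?thesis by simp
qed

end

section \<open>Choice of the constants\<close>

lemma runtime_budget:
  fixes chi c \<epsilon> \<eta> N l y bs w v A L :: real
  assumes pos: "chi > 0" "\<epsilon> > 0" "c > 0" "N > 0" "l > 0" "bs \<ge> 0" "w \<ge> 0" "v \<ge> 0" "A > 0"
    and \<eta>: "\<eta> = 8 / \<epsilon>\<^sup>2"
    and y: "l * \<epsilon> * chi * (1 + \<epsilon> + \<epsilon>\<^sup>2) / (N * c) \<le> y"
    and A: "bs \<le> \<eta> / 32 * A" "v \<le> 2 * A" "1 + w \<le> A"
    and L: "ln (1 + l) \<le> 2 * L" "12 \<le> \<eta> / 2 * L"
  shows "l * (2 * (2 * N * (1 + \<eta> / 32 * ln (1 + l) + (1 + 2 / y))
                   + 2 * N / A * (1 + bs * ln (1 + l) + (w + v / y))))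
         \<le> \<eta> * (l * N * L + N\<^sup>2 * exp 1 * c / (\<epsilon> * chi))"
proof -
  let ?g = "1 + \<epsilon> + \<epsilon>\<^sup>2"
  have g: "?g > 0" using pos by (intro add_pos_nonneg) auto
  have y0: "l * \<epsilon> * chi * ?g / (N * c) > 0" using pos g by simp
  have "l / y \<le> l / (l * \<epsilon> * chi * ?g / (N * c))"
    using y y0 pos by (intro divide_left_mono mult_pos_pos) auto
  also have "\<dots> = N * c / (\<epsilon> * chi * ?g)" using pos g by (simp add: divide_simps)
  finally have ly: "l / y \<le> N * c / (\<epsilon> * chi * ?g)" .
  have ly0: "0 \<le> l / y" using pos y y0 by simp
  have vA: "v / A \<le> 2" "bs / A \<le> \<eta> / 32" "(1 + w) / A \<le> 1" using A pos by (auto simp: field_simps)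
  have ln0: "ln (1 + l) \<ge> 0" using pos by simp
  have \<eta>0: "\<eta> > 0" using pos \<eta> by simp
  have wait: "l / y * N * (8 + 4 * (v / A)) \<le> \<eta> * (N\<^sup>2 * exp 1 * c / (\<epsilon> * chi))"
  proof -
    have "l / y * N * (8 + 4 * (v / A)) \<le> l / y * N * 16"
      using vA ly0 pos by (intro mult_left_mono mult_nonneg_nonneg) auto
    also have "\<dots> \<le> N * c / (\<epsilon> * chi * ?g) * N * 16"
      using ly pos by (intro mult_right_mono) auto
    also have "\<dots> = N\<^sup>2 * c / (\<epsilon> * chi) * (16 / ?g)"
      by (simp add: power2_eq_square)
    also have "\<dots> \<le> N\<^sup>2 * c / (\<epsilon> * chi) * (\<eta> * exp 1)"
    proof (rule mult_left_mono)
      have "16 * \<epsilon>\<^sup>2 \<le> 8 * 2 * ?g" using pos by simp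
      also have "\<dots> \<le> 8 * exp 1 * ?g"
        using exp_ge_add_one_self[of 1] g by (intro mult_right_mono) auto
      finally show "16 / ?g \<le> \<eta> * exp 1"
        unfolding \<eta> using g pos by (simp add: divide_simps mult_ac)
    qed (use pos in auto)
    finally show ?thesis by (simp add: mult_ac)
  qed
  have grow: "l * N * (8 + 4 * ((1 + w) / A) + ln (1 + l) * (\<eta> / 8 + 4 * (bs / A))) \<le> \<eta> * (l * N * L)"
  proof -
    have "\<eta> / 8 + 4 * (bs / A) \<le> \<eta> / 4" "0 \<le> bs / A" "0 \<le> 2 * L"
      using vA(2) L(1) ln0 pos(6,9) by (linarith, simp, linarith)
    then have "ln (1 + l) * (\<eta> / 8 + 4 * (bs / A)) \<le> (2 * L) * (\<eta> / 4)"
      using \<eta>0 by (intro mult_mono L(1)) auto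
    moreover have "2 * L * (\<eta> / 4) = \<eta> * L / 2" "12 \<le> \<eta> * L / 2" using L(2) by auto
    ultimately have "8 + 4 * ((1 + w) / A) + ln (1 + l) * (\<eta> / 8 + 4 * (bs / A)) \<le> \<eta> * L"
      using vA(3) by argo
    then have "l * N * (8 + 4 * ((1 + w) / A) + ln (1 + l) * (\<eta> / 8 + 4 * (bs / A))) \<le> l * N * (\<eta> * L)"
      using pos by (intro mult_left_mono) auto
    then show ?thesis by (simp add: mult_ac)
  qed
  have "l * (2 * (2 * N * (1 + \<eta> / 32 * ln (1 + l) + (1 + 2 / y))
                   + 2 * N / A * (1 + bs * ln (1 + l) + (w + v / y))))
      = l * N * (8 + 4 * ((1 + w) / A) + ln (1 + l) * (\<eta> / 8 + 4 * (bs / A)))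
        + l / y * N * (8 + 4 * (v / A))"
    using pos by (simp add: algebra_simps add_divide_distrib)
  also have "\<dots> \<le> \<eta> * (l * N * L + N\<^sup>2 * exp 1 * c / (\<epsilon> * chi))"
    using wait grow by (simp add: distrib_left)
  finally show ?thesis .
qed

lemma mult_exp_minus_le:
  fixes c1 l m :: real
  assumes "c1 > 0" "c1 * l \<ge> 2 * m"
  shows "l * exp (- (c1 * l)) \<le> 4 / c1 * exp (- (3 / 2 * m))"
proof -
  have "c1 * l / 4 \<le> exp (c1 * l / 4)" using exp_ge_add_one_self[of "c1 * l / 4"] by linarith
  then have "l \<le> 4 / c1 * exp (c1 * l / 4)" using assms by (simp add: field_simps)
  then have "l * exp (- (c1 * l)) \<le> 4 / c1 * exp (c1 * l / 4) * exp (- (c1 * l))"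
    by (intro mult_right_mono) auto
  also have "\<dots> = 4 / c1 * exp (- (3 / 4 * (c1 * l)))"
    by (simp add: exp_add[symmetric] mult.assoc)
  also have "\<dots> \<le> 4 / c1 * exp (- (3 / 2 * m))"
    using assms by (intro mult_left_mono) auto
  finally show ?thesis .
qed

lemma eventually_failure_small:
  fixes B K :: real
  assumes "B > 0" "K > 0"
  shows "eventually (\<lambda>n::nat. B * (real n)\<^sup>2 * exp (- (3 / 2 * ln (K * (real n + 1)\<^sup>2))) \<le> 1) sequentially"
proof -
  have "(\<lambda>n::nat. B * (real n)\<^sup>2 * exp (- (3 / 2 * ln (K * (real n + 1)\<^sup>2)))) \<longlonglongrightarrow> 0"
    using assms by real_asymp
  then have "eventually (\<lambda>n::nat. B * (real n)\<^sup>2 * exp (- (3 / 2 * ln (K * (real n + 1)\<^sup>2))) < 1) sequentially"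
    by (rule order_tendstoD) simp
  then show ?thesis by eventually_elim simp
qed

lemma eventually_ln_bounds:
  fixes \<epsilon> C :: real
  assumes "\<epsilon> > 0"
  shows "eventually (\<lambda>l. ln (1 + l) \<le> 2 * ln (3 * \<epsilon> * l / 2) \<and> C \<le> ln (3 * \<epsilon> * l / 2)) at_top"
proof (rule eventually_conj)
  show "eventually (\<lambda>l. ln (1 + l) \<le> 2 * ln (3 * \<epsilon> * l / 2)) at_top"
    using assms by real_asymp
  have "filterlim (\<lambda>l. ln (3 * \<epsilon> * l / 2)) at_top at_top"
    using assms by real_asymp
  then show "eventually (\<lambda>l. C \<le> ln (3 * \<epsilon> * l / 2)) at_top"
    by (simp add: filterlim_at_top)
qed

lemma eventually_population_large:
  fixes B K C :: real
  assumes "B > 0" "K > 0"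
  shows "eventually (\<lambda>n::nat. C \<le> B * ln (K * (real n + 1)\<^sup>2)) sequentially"
proof -
  have "filterlim (\<lambda>n::nat. B * ln (K * (real n + 1)\<^sup>2)) at_top sequentially"
    using assms by real_asymp
  then show ?thesis by (simp add: filterlim_at_top)
qed

theorem theorem7:
  fixes chi c :: real
  assumes chi_pos: "chi > 0"
    and c_gt: "c > exp chi"
  defines "eps \<equiv> root 3 (c / exp chi) - 1"
  shows "\<exists>N::nat. \<forall>n\<ge>N. \<forall>(a :: nat \<Rightarrow> nat) (lam::nat).
           (\<forall>i<n. a i > 0) \<longrightarrow> (\<forall>i j. i \<le> j \<longrightarrow> j < n \<longrightarrow> a j \<le> a i) \<longrightarrow>
           real lam \<ge> 4 * c / eps ^ 3 * ln (128 * (real n + 1) ^ 2 * c * exp 1 / (eps ^ 3 * chi)) \<longrightarrow>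
           expected_runtime n lam (linf a)
              (ea_step (fp_select (\<lambda>x. c ^ linf a x)) (mutate chi n))
           \<le> ennreal (8 / eps ^ 2 * (real lam * real n * ln (3 * eps * real lam / 2)
                                     + real n ^ 2 * exp 1 * c / (eps * chi)))"
proof -
  have ratio: "c / exp chi > 1" using c_gt by simp
  have eps: "eps > 0" unfolding eps_def using real_root_gt_1_iff[of 3 "c / exp chi"] ratio by simp
  have "root 3 (c / exp chi) ^ 3 = c / exp chi" by (rule real_root_pow_pos2) (use ratio in linarith)+
  then have "(1 + eps) ^ 3 = c / exp chi" by (simp add: eps_def)
  then have c_eq: "c = exp chi * (1 + eps) ^ 3" by simp
  have c1: "c > 1" using c_gt chi_pos one_less_exp_iff[of chi] by linarith
  define \<eta> where "\<eta> = 8 / eps\<^sup>2"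
  have \<eta>: "\<eta> > 0" using eps by (simp add: \<eta>_def)
  obtain h where h: "2 * exp (32 / \<eta>) < c ^ h" using real_arch_pow[OF c1] by blast
  have e1: "exp (32 / \<eta>) > 1" using \<eta> by simp
  have h1: "h \<ge> 1" using h e1 by (cases h) auto
  have "exp (32 / \<eta>) \<le> c ^ h / 2" using h by simp
  then have "32 / \<eta> \<le> ln (c ^ h / 2)" using c1 by (simp add: ln_ge_iff)
  then have fast_ln: "1 \<le> \<eta> / 32 * ln (c ^ h / 2)" using \<eta> by (simp add: field_simps)
  have ch2: "c ^ h \<ge> 2" using h e1 by linarith
  define g where "g = 1 + eps + eps\<^sup>2"
  have g1: "g > 1" using eps by (simp add: g_def add_pos_pos)
  obtain bs w v \<kappa> where bs: "bs > 0" "w \<ge> 0" "v \<ge> 0"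
    and slow: "\<And>y. y > 0 \<Longrightarrow> admissible_cost g y bs (w + v / y) \<kappa>"
    by (rule admissible_cost_slow[OF g1]) blast
  obtain A :: nat where A: "32 * bs / \<eta> + v + 1 + w \<le> real A" using real_arch_simple by blast
  have A_ge: "bs \<le> \<eta> / 32 * real A" "v \<le> 2 * real A" "1 + w \<le> real A" "A \<ge> 1"
  proof -
    have nn: "32 * bs / \<eta> \<ge> 0" using bs \<eta> by simp
    have "32 * bs / \<eta> \<le> real A" using A bs by linarith
    then show "bs \<le> \<eta> / 32 * real A" using \<eta> by (simp add: field_simps)
    show "v \<le> 2 * real A" "1 + w \<le> real A" using A bs nn by linarith+
    then show "A \<ge> 1" using bs by linarith
  qed
  obtain \<Lambda> where \<Lambda>: "\<And>l. l \<ge> \<Lambda> \<Longrightarrow> ln (1 + l) \<le> 2 * ln (3 * eps * l / 2) \<and> 24 / \<eta> \<le> ln (3 * eps * l / 2)"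
    using eventually_ln_bounds[OF eps, of "24 / \<eta>"] unfolding eventually_at_top_linorder by blast
  define c1' where "c1' = eps ^ 3 / (2 * c)"
  define B where "B = \<eta> * (3 * eps / 2 + exp 1 * c / (eps * chi))"
  define K where "K = 128 * c * exp 1 / (eps ^ 3 * chi)"
  have c1': "c1' > 0" and B: "B > 0" and K: "K > 0"
    using eps c1 chi_pos \<eta> by (auto simp: c1'_def B_def K_def intro!: mult_pos_pos add_pos_pos divide_pos_pos)
  have stay_limit: "eventually (\<lambda>n. exp (- chi) * g / (1 + eps)\<^sup>2 \<le> (1 - chi / real n) ^ n) sequentially"
  proof -
    have "(\<lambda>n. (1 + (- chi) / real n) ^ n) \<longlonglongrightarrow> exp (- chi)" by (rule tendsto_exp_limit_sequentially)
    moreover have "g < (1 + eps)\<^sup>2" using eps by (simp add: g_def power2_eq_square algebra_simps)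
    then have "exp (- chi) * g / (1 + eps)\<^sup>2 < exp (- chi)"
      using eps by (simp add: pos_divide_less_eq)
    ultimately have "eventually (\<lambda>n. exp (- chi) * g / (1 + eps)\<^sup>2 < (1 + (- chi) / real n) ^ n) sequentially"
      by (rule order_tendstoD(1))
    then show ?thesis by eventually_elim simp
  qed
  let ?large = "\<lambda>x::real. eventually (\<lambda>n::nat. x \<le> real n) sequentially"
  have large: "?large x" for x
    using filterlim_real_sequentially by (simp add: filterlim_at_top)
  have "eventually (\<lambda>n::nat. 2 * chi \<le> real n \<and> real A \<le> real n \<and> real (18 * h ^ 2 * A) \<le> real n \<and>
      2 * chi * (18 * real h ^ 2 * real A / chi) ^ (3 * h) \<le> real n \<and>
      exp (- chi) * g / (1 + eps)\<^sup>2 \<le> (1 - chi / real n) ^ n \<and>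
      max 1 \<Lambda> \<le> 4 * c / eps ^ 3 * ln (K * (real n + 1)\<^sup>2) \<and>
      B * (4 / c1') * (real n)\<^sup>2 * exp (- (3 / 2 * ln (K * (real n + 1)\<^sup>2))) \<le> 1) sequentially"
    using B K c1' c1 eps
    by (intro eventually_conj large stay_limit eventually_population_large eventually_failure_small) auto
  then obtain N where N: "\<And>n. n \<ge> N \<Longrightarrow> 2 * chi \<le> real n \<and> real A \<le> real n \<and> real (18 * h ^ 2 * A) \<le> real n \<and>
      2 * chi * (18 * real h ^ 2 * real A / chi) ^ (3 * h) \<le> real n \<and>
      exp (- chi) * g / (1 + eps)\<^sup>2 \<le> (1 - chi / real n) ^ n \<and>
      max 1 \<Lambda> \<le> 4 * c / eps ^ 3 * ln (K * (real n + 1)\<^sup>2) \<and>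
      B * (4 / c1') * (real n)\<^sup>2 * exp (- (3 / 2 * ln (K * (real n + 1)\<^sup>2))) \<le> 1"
    unfolding eventually_sequentially by blast
  show ?thesis
  proof (intro exI[of _ N] allI impI)
    fix n lam :: nat and a :: "nat \<Rightarrow> nat"
    assume n: "n \<ge> N" and a_pos: "\<forall>i<n. a i > 0" and a_anti: "\<forall>i j. i \<le> j \<longrightarrow> j < n \<longrightarrow> a j \<le> a i"
      and lam_ge: "real lam \<ge> 4 * c / eps ^ 3 * ln (128 * (real n + 1) ^ 2 * c * exp 1 / (eps ^ 3 * chi))"
    define l where "l = real lam"
    define M where "M = K * (real n + 1)\<^sup>2"
    have M_eq: "128 * (real n + 1) ^ 2 * c * exp 1 / (eps ^ 3 * chi) = M"
      by (simp add: M_def K_def)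
    have l_ge: "4 * c / eps ^ 3 * ln M \<le> l" using lam_ge unfolding M_eq l_def .
    have n1: "n \<ge> 1"
      using N[OF n] chi_pos by (cases n) auto
    have l: "l \<ge> 1" "l \<ge> \<Lambda>" using N[OF n] l_ge unfolding M_def by linarith+
    interpret ea_linear chi c eps n lam a
      using chi_pos eps c_eq N[OF n] l a_pos a_anti by unfold_locales (auto simp: g_def l_def)
    have y: "rate_hit > 0"
      unfolding rate_hit_def using flip_pos eps lam by simp
    define Wf where "Wf = 1 + 2 / rate_hit"
    define Ws where "Ws = w + v / rate_hit"
    have fast_adm: "admissible_cost (c ^ h) rate_hit (\<eta> / 32) Wf 1"
      unfolding Wf_def using ch2 fast_ln \<eta> y by (intro admissible_cost_fast) auto
    have slow_adm: "admissible_cost growth rate_hit bs Ws \<kappa>"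
      unfolding Ws_def using slow[OF y] by (simp add: g_def)
    have nA: "18 * h ^ 2 * A \<le> n" "A \<le> n" using N[OF n] of_nat_le_iff by blast+
    have n_big: "2 * chi * (18 * real h ^ 2 * real A / chi) ^ (3 * h) \<le> real n" using N[OF n] by blast
    note params = h1 A_ge(4) nA(1) n_big fast_adm slow_adm
    define V where "V = pot_max A (\<eta> / 32) Wf bs Ws \<kappa>"
    define RHS where "RHS = \<eta> * (l * real n * ln (3 * eps * l / 2) + (real n)\<^sup>2 * exp 1 * c / (eps * chi))"
    have "V \<le> 2 * real n * (1 + \<eta> / 32 * ln (1 + l) + Wf) + 2 * real n / real A * (1 + bs * ln (1 + l) + Ws)"
      unfolding V_def using pot_max_le[OF params nA(2)] by (simp add: level_cost_def l_def)
    then have "l * (2 * V) \<le> l * (2 * (2 * real n * (1 + \<eta> / 32 * ln (1 + l) + Wf)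
        + 2 * real n / real A * (1 + bs * ln (1 + l) + Ws)))"
      using l by (intro mult_left_mono) auto
    also have "\<dots> \<le> RHS"
      unfolding RHS_def Wf_def Ws_def
    proof (rule runtime_budget)
      show "l * eps * chi * (1 + eps + eps\<^sup>2) / (real n * c) \<le> rate_hit"
        using rate_hit_ge by (simp add: l_def)
      show "12 \<le> \<eta> / 2 * ln (3 * eps * l / 2)"
        using \<Lambda>[OF l(2)] \<eta> by (simp add: field_simps)
    qed (use chi_pos eps c1 n1 l bs A_ge \<Lambda>[OF l(2)] \<eta>_def in auto)
    finally have V_le: "l * (2 * V) \<le> RHS" .
    have small: "fail * V \<le> 1 / 2"
    proof -
      have fail_eq: "fail = exp (- (c1' * l))" by (simp add: fail_def c1'_def l_def)
      have "ln (3 * eps * l / 2) \<le> 3 * eps * l / 2"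
        using eps l ln_le_minus_one[of "3 * eps * l / 2"] by simp
      then have "l * real n * ln (3 * eps * l / 2) \<le> l * real n * (3 * eps * l / 2)"
        using l by (intro mult_left_mono) auto
      also have "\<dots> = 3 * eps / 2 * (l\<^sup>2 * real n)" by (simp add: power2_eq_square)
      also have "\<dots> \<le> 3 * eps / 2 * (l\<^sup>2 * (real n)\<^sup>2)"
        using eps n1 by (intro mult_left_mono) (auto simp: power2_eq_square)
      finally have one: "l * real n * ln (3 * eps * l / 2) \<le> 3 * eps / 2 * (l\<^sup>2 * (real n)\<^sup>2)" .
      have "(real n)\<^sup>2 * 1 \<le> (real n)\<^sup>2 * l\<^sup>2" using l by (intro mult_left_mono one_le_power) auto
      then have "exp 1 * c / (eps * chi) * (real n)\<^sup>2 \<le> exp 1 * c / (eps * chi) * (l\<^sup>2 * (real n)\<^sup>2)"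
        using eps chi_pos c1 by (intro mult_left_mono) (auto simp: mult.commute)
      then have two: "(real n)\<^sup>2 * exp 1 * c / (eps * chi) \<le> exp 1 * c / (eps * chi) * (l\<^sup>2 * (real n)\<^sup>2)"
        by (simp add: mult_ac)
      have "l * real n * ln (3 * eps * l / 2) + (real n)\<^sup>2 * exp 1 * c / (eps * chi)
          \<le> (3 * eps / 2 + exp 1 * c / (eps * chi)) * (l\<^sup>2 * (real n)\<^sup>2)"
        unfolding distrib_right by (rule add_mono[OF one two])
      then have "RHS \<le> \<eta> * ((3 * eps / 2 + exp 1 * c / (eps * chi)) * (l\<^sup>2 * (real n)\<^sup>2))"
        unfolding RHS_def using \<eta> by (intro mult_left_mono) auto
      then have "RHS \<le> B * (l\<^sup>2 * (real n)\<^sup>2)" by (simp add: B_def mult_ac)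
      then have "l * (2 * V) \<le> l * (B * (l * (real n)\<^sup>2))"
        using V_le by (simp add: power2_eq_square mult_ac)
      then have "2 * V \<le> B * (l * (real n)\<^sup>2)" using l by simp
      then have "fail * (2 * V) \<le> fail * (B * (l * (real n)\<^sup>2))"
        by (intro mult_left_mono) (auto simp: fail_def)
      also have "\<dots> = B * (real n)\<^sup>2 * (l * exp (- (c1' * l)))"
        by (simp add: fail_eq mult_ac)
      also have "\<dots> \<le> B * (real n)\<^sup>2 * (4 / c1' * exp (- (3 / 2 * ln M)))"
      proof (rule mult_left_mono[OF mult_exp_minus_le[OF c1']])
        have "c1' * (4 * c / eps ^ 3 * ln M) \<le> c1' * l" using l_ge c1' by (intro mult_left_mono) auto
        then show "2 * ln M \<le> c1' * l" using c1 eps by (simp add: c1'_def)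
      qed (use B in auto)
      also have "\<dots> \<le> 1" using N[OF n] by (simp add: M_def mult_ac)
      finally show ?thesis by simp
    qed
    have "expected_runtime n lam (linf a) step \<le> ennreal (real lam * (2 * V))"
      unfolding V_def by (rule expected_runtime_le_pot_max[OF params small[unfolded V_def]])
    also have "\<dots> \<le> ennreal RHS" using V_le by (intro ennreal_leI) (simp add: l_def)
    finally show "expected_runtime n lam (linf a)
              (ea_step (fp_select (\<lambda>x. c ^ linf a x)) (mutate chi n))
           \<le> ennreal (8 / eps ^ 2 * (real lam * real n * ln (3 * eps * real lam / 2)
                                     + real n ^ 2 * exp 1 * c / (eps * chi)))"
      by (simp only: step_def RHS_def \<eta>_def l_def)
  qed
qed

end
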